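(* Let $\alpha\in(0,1)$, let $\rho_{\rm R}=\frac{3+\sqrt{17}}2\approx3.561552812808830$ and let $\rho_{\rm L}\approx0.457332766746115$ be the positive root of $\frac{\rho^2(1+\rho)}{1-3\rho^2(1+\rho)}=\rho_{\rm R}$. There is a constant $C>0$ depending only on $\alpha$ such that the following holds. Let $0=t_0<t_1<t_2<\cdots$ be a mesh with steps $\tau_k=t_k-t_{k-1}$ and ratios $\rho_k=\tau_k/\tau_{k-1}\in[\rho_{\rm L},\rho_{\rm R}]$ for all $k\ge2$. Then for any function $u$ defined on $[0,\infty)\times\Omega$ (with $u^k=u(t_k,\cdot)\in L^2(\Omega)$ for all $k$) and any $n\ge2$, $$\mathcal B_n(u,u)=\sum_{k=1}^n\langle L_k^\alpha u,\delta_ku\rangle\ \ge\ \sum_{k=1}^n\frac{g_k(\alpha)}{2\Gamma(3-\alpha)}\|\delta_ku\|_{L^2(\Omega)}^2\ \ge\ C\sum_{k=1}^n\tau_k^{-\alpha}\|\delta_ku\|_{L^2(\Omega)}^2\ \ge\ 0,$$ where $$g_k(\alpha)=\begin{cases}\dfrac{1}{\tau_1^\alpha}\,\hat g(\alpha), & k=1,2,\\[2mm] \dfrac{\alpha}{\tau_k^\alpha}\left(\dfrac{(1+\alpha)(2-\alpha)}{\alpha}+\dfrac{\rho_{k+1}-1+\alpha}{(1+\rho_{k+1})^\alpha}-\dfrac{2\rho_{k+1}^{2-\alpha}}{1+\rho_{k+1}}-\dfrac{\rho_k(\rho_k-2)}{1+\rho_k}\right), & 3\le k\le n-1,\\[2mm]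 \dfrac{\alpha}{\tau_n^\alpha}\left(\dfrac{(1+\alpha)(2-\alpha)}{\alpha}-\dfrac{\rho_n(\rho_n-2)}{1+\rho_n}\right), & k=n\ne2,\end{cases}$$ with $\hat g(\alpha)$ defined in the context.
   Context: $\Omega\subset\mathbb R^d$ is a domain, $\langle\cdot,\cdot\rangle$ is the $L^2(\Omega)$ inner product, and $\delta_k u=u^k-u^{k-1}$. L2 operator: for $j\ge1$ let $H_2^j$ be the quadratic Lagrange polynomial in $t$ interpolating $u^{j-1},u^j,u^{j+1}$ at $t_{j-1},t_j,t_{j+1}$. Then $$L_1^\alpha u=\frac{u^1-u^0}{\Gamma(2-\alpha)\tau_1^\alpha},\qquad L_k^\alpha u=\frac1{\Gamma(1-\alpha)}\left(\sum_{j=1}^{k-1}\int_{t_{j-1}}^{t_j}\frac{\partial_sH_2^j(s)}{(t_k-s)^\alpha}ds+\int_{t_{k-1}}^{t_k}\frac{\partial_sH_2^{k-1}(s)}{(t_k-s)^\alpha}ds\right),\quad k\ge2.$$ Definition of $\hat g$: for $1\le j\le k-1$ put $$a_j^{(k)}=\int_{t_{j-1}}^{t_j}\frac{2s-t_j-t_{j+1}}{\tau_j(\tau_j+\tau_{j+1})}\frac{ds}{(t_k-s)^\alpha},\qquad c_j^{(k)}=\int_{t_{j-1}}^{t_j}\frac{2s-t_{j-1}-t_j}{\tau_{j+1}(\tau_j+\tau_{j+1})}\frac{ds}{(t_k-s)^\alpha},$$ and for $k\ge2$ $$a_k^{(k)}=\int_{t_{k-1}}^{t_k}\frac{2s-t_{k-1}-t_k}{\tau_{k-1}(\tau_{k-1}+\tau_k)}\frac{ds}{(t_k-s)^\alpha},\qquad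 c_k^{(k)}=\int_{t_{k-1}}^{t_k}\frac{2s-t_{k-2}-t_{k-1}}{\tau_k(\tau_{k-1}+\tau_k)}\frac{ds}{(t_k-s)^\alpha}.$$ Let $d_2^{(3)}=c_1^{(3)}-a_2^{(3)}$, $2\beta_1=-a_1^{(2)}$, $2\beta_2=d_2^{(3)}+a_1^{(3)}-a_1^{(2)}$, and let $\mathbf C$ be the symmetric $2\times2$ matrix with $$[\mathbf C]_{11}=\frac{2}{(1-\alpha)\tau_1^\alpha}-2\beta_1,\quad [\mathbf C]_{12}=[\mathbf C]_{21}=-a_2^{(2)},\quad [\mathbf C]_{22}=2c_1^{(2)}+2c_2^{(2)}-2\beta_2-a_3^{(3)}.$$ Then $$\hat g(\alpha)=(2-\alpha)(1-\alpha)\tau_1^\alpha\cdot\frac{[\mathbf C]_{11}+[\mathbf C]_{22}-\sqrt{([\mathbf C]_{11}-[\mathbf C]_{22})^2+4[\mathbf C]_{12}[\mathbf C]_{21}}}{2}.$$ *)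

theory Defs
  imports "HOL-Analysis.Analysis"
begin

section \<open>The domain and $L^2$\<close>

text \<open>
  Points of $d$-dimensional Euclidean space are the extensional functions
  \<open>{..<d} \<rightarrow>\<^sub>E UNIV\<close>. Having the dimension as a natural number, instead of in the type,
  makes it possible to quantify over it after the constant of the theorem has been chosen,
  so that this constant does not depend on the dimension.
\<close>

definition euclidean_top :: "nat \<Rightarrow> (nat \<Rightarrow> real) topology"
  where "euclidean_top d = product_topology (\<lambda>_. euclidean) {..<d}"

definition lebesgue_dim :: "nat \<Rightarrow> (nat \<Rightarrow> real) measure"
  where "lebesgue_dim d = completion (PiM {..<d} (\<lambda>_. lborel))"

definition is_domain :: "nat \<Rightarrow> (nat \<Rightarrow> real) set \<Rightarrow> bool"
  where "is_domain d \<Omega> \<longleftrightarrow>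
    \<Omega> \<noteq> {} \<and> openin (euclidean_top d) \<Omega> \<and> connectedin (euclidean_top d) \<Omega>"

definition lebesgue_dim_on :: "nat \<Rightarrow> (nat \<Rightarrow> real) set \<Rightarrow> (nat \<Rightarrow> real) measure"
  where "lebesgue_dim_on d \<Omega> = restrict_space (lebesgue_dim d) \<Omega>"

definition square_integrable :: "'a measure \<Rightarrow> ('a \<Rightarrow> real) \<Rightarrow> bool"
  where "square_integrable M f \<longleftrightarrow>
    f \<in> borel_measurable M \<and> integrable M (\<lambda>x. (f x)\<^sup>2)"

definition L2_inner :: "'a measure \<Rightarrow> ('a \<Rightarrow> real) \<Rightarrow> ('a \<Rightarrow> real) \<Rightarrow> real"
  where "L2_inner M f g = (LINT x|M. f x * g x)"

definition L2_nrm :: "'a measure \<Rightarrow> ('a \<Rightarrow> real) \<Rightarrow> real"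
  where "L2_nrm M f = sqrt (L2_inner M f f)"


section \<open>The mesh\<close>

definition is_mesh :: "(nat \<Rightarrow> real) \<Rightarrow> bool"
  where "is_mesh t \<longleftrightarrow> t 0 = 0 \<and> strict_mono t"

text \<open>Meaningful for \<open>k \<ge> 1\<close> and \<open>k \<ge> 2\<close>, respectively.\<close>

definition step :: "(nat \<Rightarrow> real) \<Rightarrow> nat \<Rightarrow> real"
  where "step t k = t k - t (k - 1)"

definition ratio :: "(nat \<Rightarrow> real) \<Rightarrow> nat \<Rightarrow> real"
  where "ratio t k = step t k / step t (k - 1)"

definition rho_R :: real
  where "rho_R = (3 + sqrt 17) / 2"

definition rho_L :: real
  where "rho_L = (THE r. 0 < r \<and> r\<^sup>2 * (1 + r) / (1 - 3 * r\<^sup>2 * (1 + r)) = rho_R)"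

lemma rho_L_ex1: "\<exists>!r. 0 < r \<and> r\<^sup>2 * (1 + r) / (1 - 3 * r\<^sup>2 * (1 + r)) = rho_R"
proof -
  define y where "y = rho_R / (1 + 3 * rho_R)"
  define f :: "real \<Rightarrow> real" where "f = (\<lambda>r. r\<^sup>2 * (1 + r))"
  have R: "rho_R > 0" unfolding rho_R_def by (simp add: add_pos_nonneg)
  have y: "0 < y" "y < 1" using R by (auto simp: y_def field_simps)
  have eq: "r\<^sup>2 * (1 + r) / (1 - 3 * r\<^sup>2 * (1 + r)) = rho_R \<longleftrightarrow> f r = y" for r
  proof (cases "1 - 3 * f r = 0")
    case True
    then have "f r = 1 / 3" by simp
    moreover have "y \<noteq> 1 / 3" using R by (simp add: y_def field_simps)
    ultimately show ?thesis using True R by (simp add: f_def mult.assoc)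
  next
    case False
    have "f r / (1 - 3 * f r) = rho_R \<longleftrightarrow> f r = rho_R * (1 - 3 * f r)"
      using False by (simp add: divide_eq_eq)
    also have "\<dots> \<longleftrightarrow> f r * (1 + 3 * rho_R) = rho_R" by (auto simp: algebra_simps)
    also have "\<dots> \<longleftrightarrow> f r = y" using R by (simp add: y_def eq_divide_eq)
    finally show ?thesis by (simp add: f_def mult.assoc)
  qed
  have mono: "f r < f s" if "0 \<le> r" "r < s" for r s
    unfolding f_def using that by (intro mult_strict_mono power_strict_mono) auto
  have "\<exists>r\<ge>0. r \<le> 1 \<and> f r = y"
    by (rule IVT') (use y in \<open>auto simp: f_def intro!: continuous_intros\<close>)
  then obtain r where r: "0 \<le> r" "f r = y" by blast
  with y have "0 < r" by (cases "r = 0") (auto simp: f_def)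
  show ?thesis
  proof (rule ex1I[of _ r])
    fix s assume "0 < s \<and> s\<^sup>2 * (1 + s) / (1 - 3 * s\<^sup>2 * (1 + s)) = rho_R"
    then have "0 < s" "f s = f r" using eq r by auto
    then show "s = r" using mono[of r s] mono[of s r] r by (cases r s rule: linorder_cases) auto
  qed (use r \<open>0 < r\<close> eq in auto)
qed


section \<open>The L2 operator and the bilinear form\<close>

text \<open>The quadratic polynomial through \<open>(t i, v i)\<close>, for \<open>i = j - 1, j, j + 1\<close> and \<open>j \<ge> 1\<close>.\<close>

definition H2 :: "(nat \<Rightarrow> real) \<Rightarrow> (nat \<Rightarrow> real) \<Rightarrow> nat \<Rightarrow> real \<Rightarrow> real"
  where "H2 t v j s =
      v (j - 1) * ((s - t j) * (s - t (j + 1))) / ((t (j - 1) - t j) * (t (j - 1) - t (j + 1)))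
    + v j * ((s - t (j - 1)) * (s - t (j + 1))) / ((t j - t (j - 1)) * (t j - t (j + 1)))
    + v (j + 1) * ((s - t (j - 1)) * (s - t j)) / ((t (j + 1) - t (j - 1)) * (t (j + 1) - t j))"

text \<open>
  Acts on the sequence \<open>v\<close> of the values on the mesh at one fixed point of \<open>\<Omega>\<close>;
  relevant for \<open>k \<ge> 1\<close>.
\<close>

definition L2_op :: "real \<Rightarrow> (nat \<Rightarrow> real) \<Rightarrow> nat \<Rightarrow> (nat \<Rightarrow> real) \<Rightarrow> real"
  where "L2_op \<alpha> t k v =
    (if k = 1 then (v 1 - v 0) / (Gamma (2 - \<alpha>) * step t 1 powr \<alpha>)
     else 1 / Gamma (1 - \<alpha>) *
       ((\<Sum>j = 1..k - 1. integral {t (j - 1)..t j} (\<lambda>s. deriv (H2 t v j) s / (t k - s) powr \<alpha>))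
        + integral {t (k - 1)..t k} (\<lambda>s. deriv (H2 t v (k - 1)) s / (t k - s) powr \<alpha>)))"

definition delta :: "(nat \<Rightarrow> real) \<Rightarrow> (real \<Rightarrow> 'a \<Rightarrow> real) \<Rightarrow> nat \<Rightarrow> 'a \<Rightarrow> real"
  where "delta t u k x = u (t k) x - u (t (k - 1)) x"

definition bilin ::
  "'a measure \<Rightarrow> real \<Rightarrow> (nat \<Rightarrow> real) \<Rightarrow> nat \<Rightarrow> (real \<Rightarrow> 'a \<Rightarrow> real) \<Rightarrow> (real \<Rightarrow> 'a \<Rightarrow> real) \<Rightarrow> real"
  where "bilin M \<alpha> t n u v =
    (\<Sum>k = 1..n. L2_inner M (\<lambda>x. L2_op \<alpha> t k (\<lambda>i. u (t i) x)) (delta t v k))"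


section \<open>The coefficients\<close>

text \<open>
  \<open>a_coef \<alpha> t k j\<close> and \<open>c_coef \<alpha> t k j\<close> are $a_j^{(k)}$ and $c_j^{(k)}$, for
  \<open>1 \<le> j < k\<close> and for \<open>j = k \<ge> 2\<close>.
\<close>

definition a_coef :: "real \<Rightarrow> (nat \<Rightarrow> real) \<Rightarrow> nat \<Rightarrow> nat \<Rightarrow> real"
  where "a_coef \<alpha> t k j =
    (if j < k then
       integral {t (j - 1)..t j} (\<lambda>s.
         (2 * s - t j - t (j + 1)) / (step t j * (step t j + step t (j + 1)))
         * (1 / (t k - s) powr \<alpha>))
     else
       integral {t (k - 1)..t k} (\<lambda>s.
         (2 * s - t (k - 1) - t k) / (step t (k - 1) * (step t (k - 1) + step t k))
         * (1 / (t k - s) powr \<alpha>)))"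

definition c_coef :: "real \<Rightarrow> (nat \<Rightarrow> real) \<Rightarrow> nat \<Rightarrow> nat \<Rightarrow> real"
  where "c_coef \<alpha> t k j =
    (if j < k then
       integral {t (j - 1)..t j} (\<lambda>s.
         (2 * s - t (j - 1) - t j) / (step t (j + 1) * (step t j + step t (j + 1)))
         * (1 / (t k - s) powr \<alpha>))
     else
       integral {t (k - 1)..t k} (\<lambda>s.
         (2 * s - t (k - 2) - t (k - 1)) / (step t k * (step t (k - 1) + step t k))
         * (1 / (t k - s) powr \<alpha>)))"

definition d23 :: "real \<Rightarrow> (nat \<Rightarrow> real) \<Rightarrow> real"
  where "d23 \<alpha> t = c_coef \<alpha> t 3 1 - a_coef \<alpha> t 3 2"

definition beta1 :: "real \<Rightarrow> (nat \<Rightarrow> real) \<Rightarrow> real"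
  where "beta1 \<alpha> t = - a_coef \<alpha> t 2 1 / 2"

definition beta2 :: "real \<Rightarrow> (nat \<Rightarrow> real) \<Rightarrow> real"
  where "beta2 \<alpha> t = (d23 \<alpha> t + a_coef \<alpha> t 3 1 - a_coef \<alpha> t 2 1) / 2"

definition C_mat :: "real \<Rightarrow> (nat \<Rightarrow> real) \<Rightarrow> real^2^2"
  where "C_mat \<alpha> t = vector
    [vector [2 / ((1 - \<alpha>) * step t 1 powr \<alpha>) - 2 * beta1 \<alpha> t,
             - a_coef \<alpha> t 2 2],
     vector [- a_coef \<alpha> t 2 2,
             2 * c_coef \<alpha> t 2 1 + 2 * c_coef \<alpha> t 2 2 - 2 * beta2 \<alpha> t - a_coef \<alpha> t 3 3]]"

definition g_hat :: "real \<Rightarrow> (nat \<Rightarrow> real) \<Rightarrow> real"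
  where "g_hat \<alpha> t =
    (let C = C_mat \<alpha> t in
      (2 - \<alpha>) * (1 - \<alpha>) * step t 1 powr \<alpha> *
      ((C $ 1 $ 1 + C $ 2 $ 2 - sqrt ((C $ 1 $ 1 - C $ 2 $ 2)\<^sup>2 + 4 * C $ 1 $ 2 * C $ 2 $ 1)) / 2))"

text \<open>For \<open>1 \<le> k \<le> n\<close>; the last branch is the case \<open>k = n \<noteq> 2\<close>.\<close>

definition g_coef :: "real \<Rightarrow> (nat \<Rightarrow> real) \<Rightarrow> nat \<Rightarrow> nat \<Rightarrow> real"
  where "g_coef \<alpha> t n k =
    (if k \<le> 2 then 1 / step t 1 powr \<alpha> * g_hat \<alpha> t
     else if k < n then
       \<alpha> / step t k powr \<alpha> *
         ((1 + \<alpha>) * (2 - \<alpha>) / \<alpha>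
          + (ratio t (k + 1) - 1 + \<alpha>) / (1 + ratio t (k + 1)) powr \<alpha>
          - 2 * ratio t (k + 1) powr (2 - \<alpha>) / (1 + ratio t (k + 1))
          - ratio t k * (ratio t k - 2) / (1 + ratio t k))
     else
       \<alpha> / step t n powr \<alpha> *
         ((1 + \<alpha>) * (2 - \<alpha>) / \<alpha> - ratio t n * (ratio t n - 2) / (1 + ratio t n)))"

end

theory Submission
  imports Defs
begin

text \<open>
  At a fixed point of the domain let \<open>y k\<close> be the increment $\delta_k u$. Then
  $\Gamma(1-\alpha) L_k^\alpha u$ is a linear combination of \<open>y 1, \<dots>, y k\<close>, so twice the
  sum of $\Gamma(1-\alpha) L_k^\alpha u \cdot \delta_k u$ is a quadratic form in the
  increments. It is bounded below pointwise, and the estimate is then integrated over the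
  domain.

  The entries of the quadratic form are of two kinds. The integral over the last interval
  contributes to the diagonal and to its neighbours only. All earlier intervals contribute
  the history coefficients \<open>d_coef\<close>, which fill the whole matrix. The history part,
  completed by the diagonal entries \<open>square_coef\<close>, is a sum of squares of the sums
  \<open>y i + \<dots> + y k\<close> with nonnegative weights (\<open>quadratic_form_ge_squares\<close>), provided that
  the increments of \<open>d_coef \<alpha> t k j\<close> in \<open>j\<close> are nonnegative and decrease in \<open>k\<close>.
  Integration by parts writes these increments as integrals of the derivative of the
  kernel against piecewise quadratic weights. These weights are negative on one interval,
  but the derivative of the kernel, as well as its difference between two time levels, is
  nonnegative and increasing; so it is enough that the positive part of the weights, which
  lies further to the right, has the greater mass. This comparison of masses
  (\<open>increasing_weight_inequality\<close>) holds because of the equation relating \<open>rho_L\<close> to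
  \<open>rho_R\<close>.

  What remains is a tridiagonal form. From the third row on it is estimated by sharing
  each mixed term between two squares (\<open>tridiagonal_form_ge\<close>); the same weight inequality
  turns the resulting diagonal entries into the closed expressions \<open>g_coef\<close>. The first two
  rows form the matrix \<open>C_mat\<close>, whose smaller eigenvalue is \<open>g_hat\<close> up to a factor.

  Finally the numbers \<open>g_coef\<close> are at least a constant times the power $-\alpha$ of the
  step. This is an elementary inequality in two ratios (\<open>interior_coefficient_pos\<close>), tight
  for \<open>\<alpha> \<rightarrow> 1\<close> when both ratios are equal to \<open>rho_R\<close>; it rests on \<open>rho_R\<close> being the
  positive root of \<open>x\<^sup>2 = 3 x + 2\<close>. For \<open>C_mat\<close> the same inequality and
  \<open>first_row_dominance\<close> show that both rows are diagonally dominant.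
\<close>

section \<open>Scalar inequalities for admissible ratios\<close>

text \<open>
  Bernoulli's inequality for exponents in the unit interval: Young's inequality with the
  second factor equal to 1.
\<close>

lemma powr_le_Bernoulli:
  fixes y e :: real
  assumes "0 < y" "0 \<le> e" "e \<le> 1"
  shows "y powr e \<le> 1 + e * (y - 1)"
proof -
  have "y powr e * 1 powr (1 - e) \<le> e * y + (1 - e) * 1"
    using assms by (intro Youngs_inequality_0) auto
  then show ?thesis by (simp add: algebra_simps)
qed

lemma rho_R_square: "rho_R\<^sup>2 = 3 * rho_R + 2"
  by (simp add: rho_R_def power2_eq_square algebra_simps)

lemma rho_R_bounds: "3 < rho_R" "rho_R < 4"
proof -
  have "3 < sqrt 17" "sqrt 17 < 5"
    by (auto intro!: real_less_rsqrt real_less_lsqrt)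
  then show "3 < rho_R" "rho_R < 4" by (auto simp: rho_R_def)
qed

text \<open>
  With \<open>q = rho_L\<^sup>2 (1 + rho_L)\<close> the equation defining \<open>rho_L\<close> reads
  \<open>(3 + 1 / rho_R) q = 1\<close>. As \<open>x\<^sup>2 (1 + x)\<close> increases, this equation turns into an
  inequality for all admissible ratios, and in this form the lower bound for the ratios
  enters the proof.
\<close>

lemma rho_L_facts:
  shows rho_L_ge: "1 / 4 \<le> rho_L"
    and rho_L_cubic: "rho_L \<le> x \<Longrightarrow> 1 / (x\<^sup>2 * (1 + x)) \<le> 3 + 1 / rho_R"
proof -
  have "0 < rho_L \<and> rho_L\<^sup>2 * (1 + rho_L) / (1 - 3 * rho_L\<^sup>2 * (1 + rho_L)) = rho_R"
    unfolding rho_L_def by (rule theI'[OF rho_L_ex1])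
  then have L: "0 < rho_L" and "rho_L\<^sup>2 * (1 + rho_L) / (1 - 3 * rho_L\<^sup>2 * (1 + rho_L)) = rho_R"
    by auto
  moreover define q where "q = rho_L\<^sup>2 * (1 + rho_L)"
  ultimately have "q / (1 - 3 * q) = rho_R" by (simp add: mult.assoc)
  moreover from this have "1 - 3 * q \<noteq> 0" using rho_R_bounds by auto
  ultimately have "q = rho_R * (1 - 3 * q)" by (simp add: divide_eq_eq)
  then have q: "q * (3 + 1 / rho_R) = 1"
    using rho_R_bounds by (simp add: field_simps)
  have "1 / rho_R \<le> 1" using rho_R_bounds by simp
  have "0 < q" using L by (simp add: q_def)
  have mono: "a\<^sup>2 * (1 + a) \<le> b\<^sup>2 * (1 + b)" if "0 \<le> a" "a \<le> b" for a b :: real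
    using that by (intro mult_mono power_mono) auto
  show "1 / 4 \<le> rho_L"
  proof (rule ccontr)
    assume "\<not> 1 / 4 \<le> rho_L"
    then have "q \<le> (1/4)\<^sup>2 * (1 + 1/4)" unfolding q_def using L by (intro mono) auto
    then have "q \<le> 1 / 8" by (simp add: power2_eq_square)
    then have "q * (3 + 1 / rho_R) \<le> 1 / 8 * 4"
      using \<open>0 < q\<close> \<open>1 / rho_R \<le> 1\<close> rho_R_bounds by (intro mult_mono) auto
    then show False using q by simp
  qed
  show "1 / (x\<^sup>2 * (1 + x)) \<le> 3 + 1 / rho_R" if "rho_L \<le> x"
  proof -
    have "q \<le> x\<^sup>2 * (1 + x)" unfolding q_def using L that by (intro mono) auto
    then have "1 / (x\<^sup>2 * (1 + x)) \<le> 1 / q"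
      using \<open>0 < q\<close> by (intro divide_left_mono) (auto intro: mult_pos_pos)
    also have "1 / q = 3 + 1 / rho_R" using q \<open>0 < q\<close> by (simp add: field_simps)
    finally show ?thesis .
  qed
qed

text \<open>
  The right-hand side is the value of the left-hand side at \<open>rho_R\<close>, by the quadratic
  equation of \<open>rho_R\<close>; the difference of the two values has the factor \<open>rho_R - x\<close>.
\<close>

lemma ratio_term_le:
  assumes "0 < x" "x \<le> rho_R"
  shows "x * (x - 2) / (1 + x) \<le> 2 - rho_R / (1 + rho_R)"
proof -
  have "x * (x - 2) * (1 + rho_R) \<le> (2 + rho_R) * (1 + x)"
  proof -
    have "0 \<le> (rho_R - x) * ((1 + x) * (1 + rho_R) - 3)"
    proof (rule mult_nonneg_nonneg)
      have "3 \<le> 1 * (1 + rho_R)" using rho_R_bounds by simp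
      also have "\<dots> \<le> (1 + x) * (1 + rho_R)"
        using assms rho_R_bounds by (intro mult_right_mono) auto
      finally show "0 \<le> (1 + x) * (1 + rho_R) - 3" by (rule diff_ge_0_iff_ge[THEN iffD2])
    qed (use assms in auto)
    also have "\<dots> = rho_R\<^sup>2 * (1 + x) - (1 + x) * (2 * rho_R) - x * (x - 2) * (1 + rho_R)"
      by (simp add: algebra_simps power2_eq_square)
    finally show ?thesis by (simp add: rho_R_square algebra_simps)
  qed
  then have "x * (x - 2) / (1 + x) \<le> (2 + rho_R) / (1 + rho_R)"
    using assms rho_R_bounds by (simp add: divide_simps)
  also have "(2 + rho_R) / (1 + rho_R) = 2 - rho_R / (1 + rho_R)"
    using rho_R_bounds by (simp add: divide_simps)
  finally show ?thesis .
qed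

text \<open>
  With \<open>e = 1 - \<alpha>\<close> this says \<open>\<alpha> (1 + e + e\<^sup>2) = 1 - e ^ 3 \<le> 1\<close>. The quadratic term in \<open>e\<close>
  is what makes \<open>interior_coefficient_pos\<close> uniform in \<open>y\<close>.
\<close>

lemma reciprocal_term_ge:
  fixes \<alpha> :: real
  assumes "0 < \<alpha>" "\<alpha> < 1"
  shows "2 + 3 * (1 - \<alpha>) + 2 * (1 - \<alpha>)\<^sup>2 \<le> (1 + \<alpha>) * (2 - \<alpha>) / \<alpha>"
proof -
  define e where "e = 1 - \<alpha>"
  have "\<alpha> = 1 - e" "0 \<le> e" by (auto simp: e_def assms less_imp_le)
  have "\<alpha> * (2 + 3 * e + 2 * e\<^sup>2) = (1 + \<alpha>) * (2 - \<alpha>) - 2 * e ^ 3"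
    unfolding \<open>\<alpha> = 1 - e\<close> by (simp add: algebra_simps power2_eq_square power3_eq_cube)
  also have "\<dots> \<le> (1 + \<alpha>) * (2 - \<alpha>)" using \<open>0 \<le> e\<close> by simp
  finally have "\<alpha> * (2 + 3 * e + 2 * e\<^sup>2) \<le> (1 + \<alpha>) * (2 - \<alpha>)" .
  then show ?thesis using assms by (simp add: e_def pos_le_divide_eq mult.commute)
qed

lemma le_rho_R_quadratic:
  assumes "0 < y" "y \<le> rho_R"
  shows "y\<^sup>2 \<le> 3 * y + 2"
proof -
  have "0 \<le> (rho_R - y) * (rho_R + y - 3)"
    using assms rho_R_bounds by (intro mult_nonneg_nonneg) auto
  also have "\<dots> = rho_R\<^sup>2 - 3 * rho_R - (y\<^sup>2 - 3 * y)"
    by (simp add: algebra_simps power2_eq_square)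
  finally show ?thesis by (simp add: rho_R_square)
qed

text \<open>
  In the limit \<open>\<alpha> \<rightarrow> 1\<close> the right-hand side is 0 at \<open>x = y = rho_R\<close>, so that only estimates
  that become equalities there can be used. Let \<open>e = 1 - \<alpha>\<close> and multiply by \<open>1 + y\<close>. The
  terms without the factor \<open>e\<close> are taken care of by \<open>y / (1 + y) \<le> rho_R / (1 + rho_R)\<close>.
  Of the two copies of \<open>y powr (1 + e)\<close> one is absorbed by \<open>y (1 + y) powr e\<close>; Bernoulli's
  inequality applied to the other one leaves \<open>e\<close> times a quadratic polynomial in \<open>y\<close>,
  which is positive because \<open>y\<^sup>2 \<le> 3 y + 2\<close> up to \<open>rho_R\<close>.
\<close>

lemma interior_coefficient_pos:
  fixes \<alpha> x y :: real
  assumes \<alpha>: "0 < \<alpha>" "\<alpha> < 1" and x: "0 < x" "x \<le> rho_R" and y: "0 < y" "y \<le> rho_R"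
  shows "(1 - \<alpha>)\<^sup>2 \<le> (1 + \<alpha>) * (2 - \<alpha>) / \<alpha> + (y - 1 + \<alpha>) / (1 + y) powr \<alpha>
            - 2 * y powr (2 - \<alpha>) / (1 + y) - x * (x - 2) / (1 + x)"
proof -
  define e where "e = 1 - \<alpha>"
  have e: "0 < e" "e < 1" using \<alpha> by (auto simp: e_def)
  define p where "p = y powr e"
  define s where "s = (1 + y) powr e"
  have s: "s \<le> 1 + e * y" using powr_le_Bernoulli[of "1 + y" e] y e by (simp add: s_def)
  have p: "p \<le> 1 + e * (y - 1)" using powr_le_Bernoulli[of y e] y e by (simp add: p_def)
  have ps: "p \<le> s" unfolding p_def s_def using y e by (intro powr_mono2) auto
  have 1: "y powr (2 - \<alpha>) = y * p"
    using y by (simp add: p_def e_def powr_mult_base)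
  have 2: "1 / (1 + y) powr \<alpha> = s / (1 + y)"
    using y by (simp add: s_def e_def powr_diff)
  have "y / (1 + y) \<le> rho_R / (1 + rho_R)"
    using y by (simp add: divide_simps mult.commute algebra_simps)
  then have "y / (1 + y) + x * (x - 2) / (1 + x) \<le> 2" using ratio_term_le[OF x] by simp
  then have A: "3 * e + 2 * e\<^sup>2 + y / (1 + y) \<le> (1 + \<alpha>) * (2 - \<alpha>) / \<alpha> - x * (x - 2) / (1 + x)"
    using reciprocal_term_ge[OF \<alpha>] by (simp add: e_def)
  have "e\<^sup>2 * (1 + y) \<le> (3 * e + 2 * e\<^sup>2) * (1 + y) + y + (y - e) * s - 2 * y * p"
  proof -
    have "y * p \<le> y * s" "y * p \<le> y * (1 + e * (y - 1))" "e * s \<le> e * (1 + e * y)"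
      using ps p s e y by (auto intro!: mult_left_mono)
    moreover have "e * y\<^sup>2 \<le> e * (3 * y + 2)"
      using le_rho_R_quadratic[OF y] e by (intro mult_left_mono) auto
    moreover have "0 \<le> e * y + e * e" using e y by (intro add_nonneg_nonneg) auto
    ultimately show ?thesis by (simp add: algebra_simps power2_eq_square)
  qed
  then have "e\<^sup>2 \<le> ((3 * e + 2 * e\<^sup>2) * (1 + y) + y + (y - e) * s - 2 * y * p) / (1 + y)"
    using y by (simp add: pos_le_divide_eq)
  also have "\<dots> = 3 * e + 2 * e\<^sup>2 + y / (1 + y) + (y - e) * (s / (1 + y)) - 2 * (y * p) / (1 + y)"
    using y by (simp add: add_divide_distrib diff_divide_distrib)
  finally have "e\<^sup>2 \<le> (1 + \<alpha>) * (2 - \<alpha>) / \<alpha> - x * (x - 2) / (1 + x)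
      + (y - e) * (s / (1 + y)) - 2 * (y * p) / (1 + y)"
    using A by simp
  moreover have "y - e = y - 1 + \<alpha>" by (simp add: e_def)
  then have "(y - e) * (s / (1 + y)) = (y - 1 + \<alpha>) / (1 + y) powr \<alpha>"
    by (simp add: 2[symmetric])
  ultimately show ?thesis unfolding 1 e_def by argo
qed

lemma last_coefficient_pos:
  fixes \<alpha> x :: real
  assumes \<alpha>: "0 < \<alpha>" "\<alpha> < 1" and x: "0 < x" "x \<le> rho_R"
  shows "(1 - \<alpha>)\<^sup>2 \<le> (1 + \<alpha>) * (2 - \<alpha>) / \<alpha> - x * (x - 2) / (1 + x)"
proof -
  define q where "q = (1 - \<alpha>)\<^sup>2"
  have "0 \<le> rho_R / (1 + rho_R)" using rho_R_bounds by simp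
  moreover have "0 \<le> q" by (simp add: q_def)
  ultimately show ?thesis
    using reciprocal_term_ge[OF \<alpha>] ratio_term_le[OF x] \<alpha> unfolding q_def[symmetric] by argo
qed

text \<open>
  The term \<open>\<alpha> x (1 + x) powr (- \<alpha>)\<close> outweighs one copy of \<open>\<alpha> x powr (2 - \<alpha>) / (1 + x)\<close>. It
  remains to bound \<open>\<alpha> x powr (1 - \<alpha>)\<close> by \<open>4 / 3\<close>, the maximum over \<open>e = 1 - \<alpha>\<close> of the
  bound \<open>(1 - e) (1 + 3 e)\<close> that Bernoulli's inequality gives for \<open>x \<le> 4\<close>.
\<close>

lemma first_row_dominance:
  fixes \<alpha> x :: real
  assumes \<alpha>: "0 < \<alpha>" "\<alpha> < 1" and x: "0 < x" "x \<le> rho_R"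
  shows "1 / 2 \<le> 2 * (2 - \<alpha>)
      - ((1 + x) powr (- \<alpha>) * (2 * (1 - \<alpha>) - \<alpha> * x) + \<alpha> * x powr (2 - \<alpha>) / (1 + x))
      - \<alpha> * x powr (2 - \<alpha>) / (1 + x)"
proof -
  define e where "e = 1 - \<alpha>"
  have e: "0 < e" "e < 1" "\<alpha> = 1 - e" using \<alpha> by (auto simp: e_def)
  define p where "p = x powr e"
  define s where "s = (1 + x) powr e"
  have ps: "p \<le> s" unfolding p_def s_def using x e by (intro powr_mono2) auto
  have 1: "x powr (2 - \<alpha>) = x * p"
    using x by (simp add: p_def e_def powr_mult_base)
  have 2: "(1 + x) powr (- \<alpha>) = s / (1 + x)"
    using x by (simp add: s_def e_def powr_diff powr_minus_divide)
  have small: "s / (1 + x) \<le> 1"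
    unfolding 2[symmetric] using x \<alpha> by (simp add: powr_minus_divide ge_one_powr_ge_zero)
  have "p \<le> 1 + e * (x - 1)" using powr_le_Bernoulli[of x e] x e by (simp add: p_def)
  also have "\<dots> \<le> 1 + e * 3" using x e rho_R_bounds by simp
  finally have "\<alpha> * p \<le> (1 - e) * (1 + e * 3)" unfolding e(3) using e by (intro mult_left_mono) auto
  also have "\<dots> = 4/3 - 3 * (e - 1/3)\<^sup>2" by (simp add: algebra_simps power2_eq_square)
  also have "\<dots> \<le> 4/3" by simp
  finally have "\<alpha> * p \<le> 4/3" .
  moreover have "x / (1 + x) \<le> 1" "0 \<le> x / (1 + x)" using x by auto
  moreover have "0 \<le> \<alpha> * p" using \<alpha> by (simp add: p_def)
  ultimately have "\<alpha> * p * (x / (1 + x)) \<le> 4/3 * 1" by (intro mult_mono) auto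
  moreover have "\<alpha> * p * (x / (1 + x)) \<le> \<alpha> * s * (x / (1 + x))"
    using ps \<alpha> x by (intro mult_right_mono mult_left_mono) auto
  moreover have "(s / (1 + x)) * (2 * e) \<le> 1 * (2 * e)"
    using small e by (intro mult_right_mono) auto
  moreover have "s / (1 + x) * (2 * (1 - \<alpha>) - \<alpha> * x)
      = s / (1 + x) * (2 * e) - \<alpha> * s * (x / (1 + x))"
    by (simp add: e_def right_diff_distrib)
  moreover have "\<alpha> * (x * p) / (1 + x) = \<alpha> * p * (x / (1 + x))" by simp
  ultimately show ?thesis unfolding 1 2 e_def by argo
qed

text \<open>
  Thus \<open>step t 1 powr (- \<alpha>)\<close> and \<open>step t 2 powr (- \<alpha>)\<close> are equal up to the factor 4, for
  every mesh.
\<close>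

lemma powr_ratio_bounds:
  fixes \<alpha> x :: real
  assumes \<alpha>: "0 < \<alpha>" "\<alpha> < 1" and x: "rho_L \<le> x" "x \<le> rho_R"
  shows "1 / 4 \<le> x powr (- \<alpha>)" "x powr (- \<alpha>) \<le> 4"
proof -
  have x': "1/4 \<le> x" "x \<le> 4" using x rho_L_ge rho_R_bounds by auto
  have "x powr \<alpha> \<le> 4 powr \<alpha>" using x' \<alpha> by (intro powr_mono2) auto
  also have "\<dots> \<le> 4 powr 1" using \<alpha> by (intro powr_mono) auto
  finally show "1 / 4 \<le> x powr (- \<alpha>)" using x' by (simp add: powr_minus_divide divide_simps)
  have "x powr (- \<alpha>) \<le> (1/4) powr (- \<alpha>)" using x' \<alpha> by (intro powr_mono2') auto
  also have "\<dots> = 4 powr \<alpha>" by (simp add: powr_minus_divide powr_divide)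
  also have "\<dots> \<le> 4 powr 1" using \<alpha> by (intro powr_mono) auto
  finally show "x powr (- \<alpha>) \<le> 4" by simp
qed

section \<open>Integrals against the weakly singular kernel\<close>

lemma has_real_derivative_reflected_powr:
  fixes T c s :: real
  assumes "s < T"
  shows "((\<lambda>s. (T - s) powr c) has_real_derivative - c * (T - s) powr (c - 1)) (at s)"
proof -
  have "((\<lambda>s. (T - s) powr c) has_real_derivative (c * (T - s) powr (c - 1)) * (0 - 1)) (at s)"
    using assms by (intro DERIV_chain2[OF has_real_derivative_powr] derivative_intros) auto
  then show ?thesis by simp
qed

lemma integral_by_parts_kernel:
  fixes p p' :: "real \<Rightarrow> real"
  assumes "a \<le> b" "b < T" and p: "\<And>s. (p has_real_derivative p' s) (at s)"
    and cont: "continuous_on {a..b} p'"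
  shows "integral {a..b} (\<lambda>s. p' s * (1 / (T - s) powr \<alpha>))
    = p b * (T - b) powr (- \<alpha>) - p a * (T - a) powr (- \<alpha>)
      - integral {a..b} (\<lambda>s. p s * (\<alpha> * (T - s) powr (- \<alpha> - 1)))"
proof -
  let ?f = "\<lambda>s. p' s * (1 / (T - s) powr \<alpha>)" and ?g = "\<lambda>s. p s * (\<alpha> * (T - s) powr (- \<alpha> - 1))"
  have "((\<lambda>s. ?f s + ?g s) has_integral p b * (T - b) powr (- \<alpha>) - p a * (T - a) powr (- \<alpha>)) {a..b}"
  proof (rule fundamental_theorem_of_calculus[OF \<open>a \<le> b\<close>])
    fix s assume s: "s \<in> {a..b}"
    then have "s < T" using assms by auto
    have "((\<lambda>s. p s * (T - s) powr (- \<alpha>)) has_real_derivative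
        p' s * (T - s) powr (- \<alpha>) + (- (- \<alpha>) * (T - s) powr (- \<alpha> - 1)) * p s) (at s)"
      by (rule DERIV_mult[OF p has_real_derivative_reflected_powr[OF \<open>s < T\<close>]])
    moreover have "p' s * (T - s) powr (- \<alpha>) + (- (- \<alpha>) * (T - s) powr (- \<alpha> - 1)) * p s = ?f s + ?g s"
      by (simp add: powr_minus_divide mult.commute)
    ultimately have "((\<lambda>s. p s * (T - s) powr (- \<alpha>)) has_real_derivative ?f s + ?g s) (at s)"
      by (simp only:)
    then show "((\<lambda>s. p s * (T - s) powr (- \<alpha>)) has_vector_derivative ?f s + ?g s) (at s within {a..b})"
      unfolding has_real_derivative_iff_has_vector_derivative[symmetric]
      by (rule has_field_derivative_at_within)
  qed
  moreover have "continuous_on {a..b} p"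
    using p by (meson DERIV_isCont continuous_at_imp_continuous_on)
  then have "?f integrable_on {a..b}" "?g integrable_on {a..b}"
    using assms by (auto intro!: integrable_continuous_interval continuous_intros)
  ultimately show ?thesis
    by (simp add: integral_unique integral_add[symmetric] eq_diff_eq)
qed

text \<open>
  The endpoint \<open>q = T\<close>, where the kernel is singular, is included because the primitive is
  continuous there; this is the case of the integrals over the last mesh interval.
\<close>

lemma has_integral_affine_kernel:
  fixes A B :: real
  assumes "p \<le> q" "q \<le> T" "0 < \<alpha>" "\<alpha> < 1"
  shows "((\<lambda>s. (A + B * (T - s)) * (1 / (T - s) powr \<alpha>)) has_integral
    (A / (1 - \<alpha>) * ((T - p) powr (1 - \<alpha>) - (T - q) powr (1 - \<alpha>))
     + B / (2 - \<alpha>) * ((T - p) powr (2 - \<alpha>) - (T - q) powr (2 - \<alpha>)))) {p..q}"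
proof -
  define F where "F = (\<lambda>s. - (A / (1 - \<alpha>) * (T - s) powr (1 - \<alpha>) + B / (2 - \<alpha>) * (T - s) powr (2 - \<alpha>)))"
  have "((\<lambda>s. (A + B * (T - s)) * (1 / (T - s) powr \<alpha>)) has_integral F q - F p) {p..q}"
  proof (rule fundamental_theorem_of_calculus_interior[OF \<open>p \<le> q\<close>])
    show "continuous_on {p..q} F"
      unfolding F_def using assms by (intro continuous_intros continuous_on_powr') auto
    fix s assume "s \<in> {p<..<q}"
    then have "s < T" using assms by auto
    have "(F has_real_derivative - (A / (1 - \<alpha>) * (- (1 - \<alpha>) * (T - s) powr (1 - \<alpha> - 1))
        + B / (2 - \<alpha>) * (- (2 - \<alpha>) * (T - s) powr (2 - \<alpha> - 1)))) (at s)"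
      unfolding F_def
      by (intro DERIV_minus DERIV_add DERIV_cmult has_real_derivative_reflected_powr \<open>s < T\<close>)
    moreover have "A / (1 - \<alpha>) * (- (1 - \<alpha>) * x) = - (A * x)" "B / (2 - \<alpha>) * (- (2 - \<alpha>) * x) = - (B * x)" for x
      using assms by (simp_all add: field_simps)
    moreover have "(T - s) powr (1 - \<alpha> - 1) = 1 / (T - s) powr \<alpha>"
      by (simp add: powr_minus_divide)
    moreover have "(T - s) powr (2 - \<alpha> - 1) = (T - s) * (1 / (T - s) powr \<alpha>)"
      using \<open>s < T\<close> by (simp add: powr_diff)
    ultimately have "(F has_real_derivative (A + B * (T - s)) * (1 / (T - s) powr \<alpha>)) (at s)"
      by (simp only: distrib_right minus_add_distrib minus_minus mult.assoc)
    then show "(F has_vector_derivative (A + B * (T - s)) * (1 / (T - s) powr \<alpha>)) (at s)"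
      by (simp add: has_real_derivative_iff_has_vector_derivative)
  qed
  then show ?thesis by (simp add: F_def algebra_simps)
qed

lemma integral_bubble:
  fixes a b :: real
  assumes "a \<le> b"
  shows "integral {a..b} (\<lambda>s. (s - a) * (b - s)) = (b - a) ^ 3 / 6"
proof -
  define F where "F = (\<lambda>s. (s - a)\<^sup>2 * (b - a) / 2 - (s - a) ^ 3 / 3)"
  have "((\<lambda>s. (s - a) * (b - s)) has_integral F b - F a) {a..b}"
  proof (rule fundamental_theorem_of_calculus[OF assms])
    fix s
    have "(F has_real_derivative (s - a) * (b - s)) (at s within {a..b})"
      unfolding F_def by (auto intro!: derivative_eq_intros simp: field_simps power2_eq_square)
    then show "(F has_vector_derivative (s - a) * (b - s)) (at s within {a..b})"
      by (simp add: has_real_derivative_iff_has_vector_derivative)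
  qed
  moreover have "F b - F a = (b - a) ^ 3 / 6" by (simp add: F_def power2_eq_square power3_eq_cube)
  ultimately show ?thesis by (simp add: integral_unique)
qed

text \<open>
  The integrand is \<open>1 + bubble_weight - left_weight\<close> on an interval of length \<open>b\<close> that is
  followed by one of length \<open>c\<close>.
\<close>

lemma integral_compensated_weight:
  fixes u b c :: real
  assumes "0 < b" "0 < c"
  shows "integral {u..u + b} (\<lambda>s. 1 + (s - u) * (u + b - s) / (c * (b + c))
      - (u + b - s) * (u + b + c - s) / (b * (b + c))) = b / 2 + b\<^sup>2 / (6 * c)" (is "integral _ ?f = _")
proof -
  define K where "K = 1 / (c * (b + c))"
  define L where "L = 1 / (b * (b + c))"
  define F where "F = (\<lambda>s. s + K * ((s - u)\<^sup>2 * b / 2 - (s - u) ^ 3 / 3)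
      + L * ((u + b - s) ^ 3 / 3 + c * (u + b - s)\<^sup>2 / 2))"
  have "(?f has_integral F (u + b) - F u) {u..u + b}"
  proof (rule fundamental_theorem_of_calculus)
    show "u \<le> u + b" using assms by simp
    fix s
    have "(F has_real_derivative 1 + K * ((s - u) * (u + b - s)) - L * ((u + b - s) * (u + b + c - s)))
        (at s within {u..u + b})"
      unfolding F_def by (auto intro!: derivative_eq_intros simp: field_simps power2_eq_square)
    then show "(F has_vector_derivative ?f s) (at s within {u..u + b})"
      by (simp add: has_real_derivative_iff_has_vector_derivative K_def L_def)
  qed
  moreover have "F (u + b) - F u = b / 2 + b\<^sup>2 / (6 * c)"
  proof -
    have bc: "b + c \<noteq> 0" using assms by simp
    have "F (u + b) - F u = b + K * (b ^ 3 / 6) - L * (b ^ 3 / 3 + c * b\<^sup>2 / 2)"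
      by (simp add: F_def power2_eq_square power3_eq_cube algebra_simps)
    also have "K = (1 / c) * (1 / (b + c))" by (simp add: K_def)
    also have "L = (1 / b) * (1 / (b + c))" by (simp add: L_def)
    also have "b + (1 / c) * (1 / (b + c)) * (b ^ 3 / 6) - (1 / b) * (1 / (b + c)) * (b ^ 3 / 3 + c * b\<^sup>2 / 2)
        = b / 2 + b\<^sup>2 / (6 * c)"
      using assms bc by (simp add: divide_simps) (simp add: algebra_simps power2_eq_square power3_eq_cube)
    finally show ?thesis .
  qed
  ultimately show ?thesis by (simp add: integral_unique)
qed

section \<open>Integration by parts on the mesh\<close>

text \<open>
  The quadratic polynomial that is 1 at \<open>t (j - 1)\<close> and vanishes at \<open>t j\<close> and \<open>t (j + 1)\<close>.
  The coefficient $a_j^{(k)}$ integrates its derivative against the kernel.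
\<close>

definition left_weight :: "(nat \<Rightarrow> real) \<Rightarrow> nat \<Rightarrow> real \<Rightarrow> real"
  where "left_weight t j s = (t j - s) * (t (j + 1) - s) / (step t j * (step t j + step t (j + 1)))"

text \<open>
  Minus the primitive, vanishing at both ends of the interval, of the factor with which
  the kernel is multiplied in $c_j^{(k)}$.
\<close>

definition bubble_weight :: "(nat \<Rightarrow> real) \<Rightarrow> nat \<Rightarrow> real \<Rightarrow> real"
  where "bubble_weight t j s = (s - t (j - 1)) * (t j - s) / (step t (j + 1) * (step t j + step t (j + 1)))"

definition kernel_deriv :: "real \<Rightarrow> (nat \<Rightarrow> real) \<Rightarrow> nat \<Rightarrow> real \<Rightarrow> real"
  where "kernel_deriv \<alpha> t k s = \<alpha> * (t k - s) powr (- \<alpha> - 1)"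

locale graded_mesh =
  fixes \<alpha> :: real and t :: "nat \<Rightarrow> real"
  assumes \<alpha>: "0 < \<alpha>" "\<alpha> < 1"
    and mesh: "is_mesh t"
    and ratios: "\<And>k. 2 \<le> k \<Longrightarrow> ratio t k \<in> {rho_L..rho_R}"
begin

lemma t_less: "i < j \<Longrightarrow> t i < t j" and t_le: "i \<le> j \<Longrightarrow> t i \<le> t j"
  using mesh by (auto simp: is_mesh_def strict_mono_less strict_mono_less_eq)

lemma step_pos: "1 \<le> k \<Longrightarrow> 0 < step t k"
  by (simp add: step_def t_less)

lemma t_eq: "t k = t (k - 1) + step t k"
  by (simp add: step_def)

lemma ratio_bounds:
  assumes "2 \<le> k"
  shows "rho_L \<le> ratio t k" "ratio t k \<le> rho_R" "0 < ratio t k" "step t k = ratio t k * step t (k - 1)"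
  using ratios[OF assms] assms rho_L_ge step_pos[of "k - 1"] by (auto simp: ratio_def)

lemma left_weight_bounds:
  assumes "1 \<le> j" "s \<in> {t (j - 1)..t j}"
  shows "0 \<le> left_weight t j s" "left_weight t j s \<le> 1"
proof -
  have h: "0 < step t j" "0 < step t (j + 1)" using assms step_pos by auto
  have "t j - s \<le> step t j" "0 \<le> t j - s" "t (j + 1) - s \<le> step t j + step t (j + 1)" "0 \<le> t (j + 1) - s"
    using assms h by (auto simp: step_def)
  then show "0 \<le> left_weight t j s" "left_weight t j s \<le> 1"
    using h by (auto simp: left_weight_def divide_le_eq_1 intro!: mult_mono)
qed

lemma bubble_weight_nonneg:
  assumes "s \<in> {t (j - 1)..t j}"
  shows "0 \<le> bubble_weight t j s"
  using assms t_le[of "j - 1" j] step_pos[of "j + 1"]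
  by (auto simp: bubble_weight_def step_def intro!: divide_nonneg_nonneg mult_nonneg_nonneg)

lemma continuous_left_weight [continuous_intros]: "continuous_on S (left_weight t j)"
  unfolding left_weight_def divide_inverse by (intro continuous_intros)

lemma continuous_bubble_weight [continuous_intros]: "continuous_on S (bubble_weight t j)"
  unfolding bubble_weight_def divide_inverse by (intro continuous_intros)

lemma continuous_kernel_deriv:
  assumes "i < k"
  shows "continuous_on {a..t i} (kernel_deriv \<alpha> t k)"
  unfolding kernel_deriv_def using t_less[OF assms] by (auto intro!: continuous_intros)

lemma kernel_deriv_nonneg: "0 \<le> kernel_deriv \<alpha> t k s"
  using \<alpha> by (simp add: kernel_deriv_def)

lemma kernel_deriv_antimono:
  assumes "s < t k"
  shows "kernel_deriv \<alpha> t (k + 1) s \<le> kernel_deriv \<alpha> t k s"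
  unfolding kernel_deriv_def using assms \<alpha> t_le[of k "k + 1"]
  by (intro mult_left_mono powr_mono2') auto

lemma kernel_deriv_mono:
  assumes "i < k"
  shows "mono_on {a..t i} (kernel_deriv \<alpha> t k)"
  unfolding kernel_deriv_def using t_less[OF assms] \<alpha>
  by (auto intro!: mono_onI mult_left_mono powr_mono2')

text \<open>
  Differences of consecutive time levels inherit monotonicity because \<open>kernel_deriv\<close> has a
  derivative of the same shape.
\<close>

lemma kernel_deriv_diff_mono:
  assumes "i < k"
  shows "mono_on {a..t i} (\<lambda>s. kernel_deriv \<alpha> t k s - kernel_deriv \<alpha> t (k + 1) s)"
proof (rule mono_onI)
  fix r s assume rs: "r \<in> {a..t i}" "s \<in> {a..t i}" "r \<le> s"
  have lt: "t i < t k" "t k < t (k + 1)" using t_less assms by auto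
  show "kernel_deriv \<alpha> t k r - kernel_deriv \<alpha> t (k + 1) r \<le> kernel_deriv \<alpha> t k s - kernel_deriv \<alpha> t (k + 1) s"
  proof (rule DERIV_nonneg_imp_nondecreasing[OF \<open>r \<le> s\<close>])
    fix x assume "r \<le> x" "x \<le> s"
    then have x: "x < t k" "x < t (k + 1)" using rs lt by auto
    let ?D = "\<alpha> * (- (- \<alpha> - 1) * (t k - x) powr (- \<alpha> - 1 - 1))
            - \<alpha> * (- (- \<alpha> - 1) * (t (k + 1) - x) powr (- \<alpha> - 1 - 1))"
    have "((\<lambda>s. kernel_deriv \<alpha> t k s - kernel_deriv \<alpha> t (k + 1) s) has_real_derivative ?D) (at x)"
      unfolding kernel_deriv_def
      by (intro DERIV_diff DERIV_cmult has_real_derivative_reflected_powr x)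
    moreover have "0 \<le> ?D"
    proof -
      have "(t (k + 1) - x) powr (- \<alpha> - 1 - 1) \<le> (t k - x) powr (- \<alpha> - 1 - 1)"
        using x lt \<alpha> by (intro powr_mono2') auto
      then show ?thesis using \<alpha> by (auto intro!: mult_left_mono)
    qed
    ultimately show "\<exists>y. ((\<lambda>s. kernel_deriv \<alpha> t k s - kernel_deriv \<alpha> t (k + 1) s) has_real_derivative y) (at x) \<and> 0 \<le> y"
      by blast
  qed
qed

lemma a_coef_by_parts:
  assumes "1 \<le> j" "j < k"
  shows "a_coef \<alpha> t k j = - ((t k - t (j - 1)) powr (- \<alpha>))
    - integral {t (j - 1)..t j} (\<lambda>s. left_weight t j s * kernel_deriv \<alpha> t k s)"
proof -
  let ?D = "step t j * (step t j + step t (j + 1))"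
  have D: "?D > 0" using step_pos[of j] step_pos[of "j + 1"] assms by auto
  have deriv: "(left_weight t j has_real_derivative (2 * s - t j - t (j + 1)) / ?D) (at s)" for s
  proof -
    have "((\<lambda>s. (t j - s) * (t (j + 1) - s)) has_real_derivative 2 * s - t j - t (j + 1)) (at s)"
      by (auto intro!: derivative_eq_intros)
    from DERIV_cdivide[OF this, of ?D] show ?thesis
      unfolding left_weight_def[abs_def] .
  qed
  have left: "left_weight t j (t (j - 1)) = 1"
  proof -
    have "t j - t (j - 1) = step t j" "t (j + 1) - t (j - 1) = step t j + step t (j + 1)"
      by (auto simp: step_def)
    moreover have "0 < step t j" "0 < step t j + step t (j + 1)"
      using step_pos[of j] step_pos[of "j + 1"] assms by auto
    ultimately show ?thesis by (simp add: left_weight_def)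
  qed
  have right: "left_weight t j (t j) = 0" by (simp add: left_weight_def)
  have "a_coef \<alpha> t k j = integral {t (j - 1)..t j} (\<lambda>s. (2 * s - t j - t (j + 1)) / ?D * (1 / (t k - s) powr \<alpha>))"
    using assms by (simp add: a_coef_def)
  also have "\<dots> = left_weight t j (t j) * (t k - t j) powr (- \<alpha>)
      - left_weight t j (t (j - 1)) * (t k - t (j - 1)) powr (- \<alpha>)
      - integral {t (j - 1)..t j} (\<lambda>s. left_weight t j s * (\<alpha> * (t k - s) powr (- \<alpha> - 1)))"
    using t_less[of j k] t_le[of "j - 1" j] assms deriv
    by (intro integral_by_parts_kernel) (auto intro!: continuous_intros simp: D[THEN less_imp_neq, symmetric] divide_inverse)
  finally show ?thesis unfolding left right by (simp add: kernel_deriv_def)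
qed

lemma c_coef_by_parts:
  assumes "j < k"
  shows "c_coef \<alpha> t k j = integral {t (j - 1)..t j} (\<lambda>s. bubble_weight t j s * kernel_deriv \<alpha> t k s)"
proof (cases "j = 0")
  case False
  let ?D = "step t (j + 1) * (step t j + step t (j + 1))"
  have D: "?D > 0" using step_pos[of j] step_pos[of "j + 1"] False by auto
  have deriv: "((\<lambda>s. - bubble_weight t j s) has_real_derivative (2 * s - t (j - 1) - t j) / ?D) (at s)" for s
  proof -
    have "((\<lambda>s. - ((s - t (j - 1)) * (t j - s))) has_real_derivative 2 * s - t (j - 1) - t j) (at s)"
      by (auto intro!: derivative_eq_intros)
    from DERIV_cdivide[OF this, of ?D] show ?thesis
      unfolding bubble_weight_def[abs_def] by simp
  qed
  have "c_coef \<alpha> t k j = integral {t (j - 1)..t j} (\<lambda>s. (2 * s - t (j - 1) - t j) / ?D * (1 / (t k - s) powr \<alpha>))"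
    using assms by (simp add: c_coef_def)
  also have "\<dots> = (- bubble_weight t j (t j)) * (t k - t j) powr (- \<alpha>)
      - (- bubble_weight t j (t (j - 1))) * (t k - t (j - 1)) powr (- \<alpha>)
      - integral {t (j - 1)..t j} (\<lambda>s. (- bubble_weight t j s) * (\<alpha> * (t k - s) powr (- \<alpha> - 1)))"
    using t_less[of j k] t_le[of "j - 1" j] assms deriv
    by (intro integral_by_parts_kernel) (auto intro!: continuous_intros simp: divide_inverse)
  finally show ?thesis by (simp add: bubble_weight_def kernel_deriv_def)
qed (use assms in \<open>simp add: c_coef_def\<close>)

lemma kernel_increment:
  assumes "1 \<le> j" "j < k"
  shows "(t k - t j) powr (- \<alpha>) = (t k - t (j - 1)) powr (- \<alpha>) + integral {t (j - 1)..t j} (kernel_deriv \<alpha> t k)"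
proof -
  have "integral {t (j - 1)..t j} (\<lambda>s. 0 * (1 / (t k - s) powr \<alpha>))
    = 1 * (t k - t j) powr (- \<alpha>) - 1 * (t k - t (j - 1)) powr (- \<alpha>)
      - integral {t (j - 1)..t j} (\<lambda>s. 1 * (\<alpha> * (t k - s) powr (- \<alpha> - 1)))"
    using t_less[of j k] t_le[of "j - 1" j] assms by (intro integral_by_parts_kernel) auto
  then show ?thesis by (simp add: kernel_deriv_def[abs_def])
qed

text \<open>
  This is where both bounds for the ratios are needed. As \<open>f\<close> increases, it is at most
  \<open>m = f (t (i - 1))\<close> on the left interval and at least \<open>m\<close> on the right one, and the
  weights are not negative. So it suffices to compare the integrals of the weights, which
  for consecutive steps \<open>a\<close>, \<open>b\<close>, \<open>c\<close> means \<open>a ^ 3 / (6 b (a + b)) \<le> b / 2 + b\<^sup>2 / (6 c)\<close>.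
  Divided by \<open>b / 6\<close> and with \<open>x = b / a\<close>, this is \<open>1 / (x\<^sup>2 (1 + x)) \<le> 3 + b / c\<close>, which
  holds as \<open>b / c\<close> is at least \<open>1 / rho_R\<close>. For \<open>i = 1\<close> the left interval is a single
  point.
\<close>

lemma increasing_weight_inequality:
  assumes "1 \<le> i" and cont: "continuous_on {t (i - 2)..t i} f"
    and mono: "mono_on {t (i - 2)..t i} f" and nonneg: "\<And>s. s \<in> {t (i - 2)..t i} \<Longrightarrow> 0 \<le> f s"
  shows "integral {t (i - 2)..t (i - 1)} (\<lambda>s. bubble_weight t (i - 1) s * f s)
    \<le> integral {t (i - 1)..t i} (\<lambda>s. (1 + bubble_weight t i s - left_weight t i s) * f s)"
proof -
  let ?w = "\<lambda>s. 1 + bubble_weight t i s - left_weight t i s"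
  have le: "t (i - 2) \<le> t (i - 1)" "t (i - 1) \<le> t i" by (auto intro: t_le)
  have cont1: "continuous_on {t (i - 2)..t (i - 1)} f" and cont2: "continuous_on {t (i - 1)..t i} f"
    using le by (auto intro: continuous_on_subset[OF cont])
  have int1: "(\<lambda>s. bubble_weight t (i - 1) s * f s) integrable_on {t (i - 2)..t (i - 1)}"
    and int2: "(\<lambda>s. ?w s * f s) integrable_on {t (i - 1)..t i}"
    using cont1 cont2 by (auto intro!: integrable_continuous_interval continuous_intros)
  have w_nonneg: "0 \<le> ?w s" if "s \<in> {t (i - 1)..t i}" for s
    using left_weight_bounds[OF assms(1) that] bubble_weight_nonneg[OF that] by simp
  show ?thesis
  proof (cases "i = 1")
    case True
    then show ?thesis using w_nonneg nonneg int2 by (auto intro!: integral_nonneg)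
  next
    case False
    define a where "a = step t (i - 1)"
    define b where "b = step t i"
    define c where "c = step t (i + 1)"
    define m where "m = f (t (i - 1))"
    have i: "2 \<le> i" using False assms by simp
    then have pos: "0 < a" "0 < b" "0 < c" unfolding a_def b_def c_def by (auto intro!: step_pos)
    have i12: "i - 1 - 1 = i - 2" by simp
    have nodes: "t (i - 1) = t (i - 2) + a" "t i = t (i - 1) + b" "t (i + 1) = t (i - 1) + b + c"
      using i12 by (auto simp: a_def b_def c_def step_def)
    have m: "0 \<le> m" using nonneg le by (simp add: m_def)
    have "integral {t (i - 2)..t (i - 1)} (\<lambda>s. bubble_weight t (i - 1) s * f s)
        \<le> integral {t (i - 2)..t (i - 1)} (\<lambda>s. (s - t (i - 2)) * (t (i - 1) - s) * (m / (b * (a + b))))"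
    proof (rule integral_le[OF int1])
      fix s assume s: "s \<in> {t (i - 2)..t (i - 1)}"
      then have "f s \<le> m" unfolding m_def using le by (intro mono_onD[OF mono]) auto
      moreover have "0 \<le> bubble_weight t (i - 1) s" using s i12 by (intro bubble_weight_nonneg) simp
      ultimately have "bubble_weight t (i - 1) s * f s \<le> bubble_weight t (i - 1) s * m"
        by (rule mult_left_mono)
      then show "bubble_weight t (i - 1) s * f s \<le> (s - t (i - 2)) * (t (i - 1) - s) * (m / (b * (a + b)))"
        using i i12 by (simp add: bubble_weight_def a_def b_def)
    qed (use pos in \<open>auto intro!: integrable_continuous_interval continuous_intros\<close>)
    also have "\<dots> = a ^ 3 / 6 * (m / (b * (a + b)))"
      unfolding integral_mult_left integral_bubble[OF le(1)] by (simp add: a_def step_def numeral_2_eq_2)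
    also have "\<dots> = m * (a ^ 3 / (6 * b * (a + b)))" by (simp add: mult.commute mult.assoc)
    also have "\<dots> \<le> m * (b / 2 + b\<^sup>2 / (6 * c))"
    proof (rule mult_left_mono[OF _ m])
      define x where "x = ratio t i"
      have x: "rho_L \<le> x" "b = x * a" "0 < x"
        using ratio_bounds[OF i] by (auto simp: x_def a_def b_def)
      have "c / b \<le> rho_R" using ratio_bounds(2)[of "i + 1"] i by (simp add: ratio_def b_def c_def)
      then have "c \<le> rho_R * b" using pos by (simp add: pos_divide_le_eq)
      then have "1 / rho_R \<le> b / c" using pos rho_R_bounds by (simp add: field_simps)
      then have "1 / (x\<^sup>2 * (1 + x)) \<le> 3 + b / c" using rho_L_cubic[OF x(1)] by simp
      then have "b / 6 * (1 / (x\<^sup>2 * (1 + x))) \<le> b / 6 * (3 + b / c)"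
        using pos by (intro mult_left_mono) auto
      also have "b / 6 * (3 + b / c) = b / 2 + b\<^sup>2 / (6 * c)"
        by (simp add: algebra_simps power2_eq_square)
      also have "b / 6 * (1 / (x\<^sup>2 * (1 + x))) = a ^ 3 / (6 * b * (a + b))"
      proof -
        have "a + b = a * (1 + x)" "1 + x \<noteq> 0" using x by (auto simp: algebra_simps)
        then show ?thesis unfolding x(2) using x(3) pos(1)
          by (simp add: divide_simps power2_eq_square power3_eq_cube)
      qed
      finally show "a ^ 3 / (6 * b * (a + b)) \<le> b / 2 + b\<^sup>2 / (6 * c)" .
    qed
    also have "\<dots> = m * integral {t (i - 1)..t i} ?w"
      unfolding left_weight_def bubble_weight_def b_def[symmetric] c_def[symmetric] nodes(2,3)
        integral_compensated_weight[OF pos(2,3)] ..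
    also have "\<dots> = integral {t (i - 1)..t i} (\<lambda>s. m * ?w s)" by (rule integral_mult_right[symmetric])
    also have "\<dots> \<le> integral {t (i - 1)..t i} (\<lambda>s. ?w s * f s)"
    proof (rule integral_le[OF _ int2])
      fix s assume s: "s \<in> {t (i - 1)..t i}"
      then have "m \<le> f s" unfolding m_def using le by (intro mono_onD[OF mono]) auto
      then show "m * ?w s \<le> ?w s * f s" using w_nonneg[OF s] by (simp add: mult.commute mult_right_mono)
    qed (auto intro!: integrable_continuous_interval continuous_intros)
    finally show ?thesis .
  qed
qed

end

section \<open>Monotonicity of the history coefficients\<close>

text \<open>
  The coefficient of $\delta_j u$ in $\Gamma(1-\alpha) L_k^\alpha u$ for \<open>j < k\<close>, up to
  the contribution of the last interval, which only concerns \<open>j = k - 1\<close>. As \<open>0 - 1 = 0\<close>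
  on natural numbers, the integrals with index 0 extend over the single point \<open>t 0\<close>.
  Therefore one formula covers \<open>j = 1\<close>, where $c_{j-1}^{(k)}$ should be absent, and gives
  0 for \<open>j = 0\<close>.
\<close>

definition d_coef :: "real \<Rightarrow> (nat \<Rightarrow> real) \<Rightarrow> nat \<Rightarrow> nat \<Rightarrow> real"
  where "d_coef \<alpha> t k j = c_coef \<alpha> t k (j - 1) - a_coef \<alpha> t k j"

text \<open>
  After integration by parts this is the difference of the two sides of
  \<open>increasing_weight_inequality\<close> for \<open>f = kernel_deriv \<alpha> t k\<close>. Both the increments of
  \<open>d_coef\<close> in \<open>j\<close> and the bounds for the diagonal entries contain it.
\<close>

definition excess :: "real \<Rightarrow> (nat \<Rightarrow> real) \<Rightarrow> nat \<Rightarrow> nat \<Rightarrow> real"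
  where "excess \<alpha> t k i = c_coef \<alpha> t k i - d_coef \<alpha> t k i + (t k - t i) powr (- \<alpha>)"

text \<open>
  The number $2\beta_k$: the diagonal entry with which the off-diagonal entries \<open>d_coef\<close>
  are completed to a sum of squares.
\<close>

definition square_coef :: "real \<Rightarrow> (nat \<Rightarrow> real) \<Rightarrow> nat \<Rightarrow> real"
  where "square_coef \<alpha> t k = d_coef \<alpha> t (k + 1) k - d_coef \<alpha> t (k + 1) (k - 1) + d_coef \<alpha> t k (k - 1)"

lemma c_coef_0: "0 < k \<Longrightarrow> c_coef \<alpha> t k 0 = 0"
  by (simp add: c_coef_def)

lemma d_coef_0: "0 < k \<Longrightarrow> d_coef \<alpha> t k 0 = 0"
  by (simp add: d_coef_def a_coef_def c_coef_0)

context graded_mesh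
begin

lemma integrable_weight_kernel:
  assumes "i < k"
  shows "kernel_deriv \<alpha> t k integrable_on {a..t i}"
    and "(\<lambda>s. left_weight t j s * kernel_deriv \<alpha> t k s) integrable_on {a..t i}"
    and "(\<lambda>s. bubble_weight t j s * kernel_deriv \<alpha> t k s) integrable_on {a..t i}"
  using continuous_kernel_deriv[OF assms, of a]
  by (auto intro!: integrable_continuous_interval continuous_intros)

lemma c_coef_nonneg: "j < k \<Longrightarrow> 0 \<le> c_coef \<alpha> t k j"
  unfolding c_coef_by_parts
  by (intro integral_nonneg integrable_weight_kernel mult_nonneg_nonneg kernel_deriv_nonneg
      bubble_weight_nonneg)

lemma left_integral_nonneg:
  assumes "1 \<le> j" "j < k"
  shows "0 \<le> integral {t (j - 1)..t j} (\<lambda>s. left_weight t j s * kernel_deriv \<alpha> t k s)"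
  using assms left_weight_bounds[OF assms(1)] kernel_deriv_nonneg
  by (intro integral_nonneg integrable_weight_kernel mult_nonneg_nonneg) auto

lemma left_integral_antimono:
  assumes "1 \<le> j" "j < k"
  shows "integral {t (j - 1)..t j} (\<lambda>s. left_weight t j s * kernel_deriv \<alpha> t (k + 1) s)
    \<le> integral {t (j - 1)..t j} (\<lambda>s. left_weight t j s * kernel_deriv \<alpha> t k s)"
proof (rule integral_le)
  fix s assume s: "s \<in> {t (j - 1)..t j}"
  then have "s < t k" using t_less[OF assms(2)] by auto
  then show "left_weight t j s * kernel_deriv \<alpha> t (k + 1) s \<le> left_weight t j s * kernel_deriv \<alpha> t k s"
    using left_weight_bounds[OF assms(1) s] kernel_deriv_antimono by (intro mult_left_mono) auto
qed (use assms in \<open>auto intro!: integrable_weight_kernel\<close>)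

lemma excess_eq_integral:
  assumes "1 \<le> i" "i < k"
  shows "excess \<alpha> t k i
    = integral {t (i - 1)..t i} (\<lambda>s. (1 + bubble_weight t i s - left_weight t i s) * kernel_deriv \<alpha> t k s)
      - integral {t (i - 2)..t (i - 1)} (\<lambda>s. bubble_weight t (i - 1) s * kernel_deriv \<alpha> t k s)"
proof -
  let ?K = "kernel_deriv \<alpha> t k" and ?I = "{t (i - 1)..t i}"
  have "integral ?I (\<lambda>s. (1 + bubble_weight t i s - left_weight t i s) * ?K s)
      = integral ?I (\<lambda>s. (?K s + bubble_weight t i s * ?K s) - left_weight t i s * ?K s)"
    by (simp add: algebra_simps)
  also have "\<dots> = integral ?I ?K + integral ?I (\<lambda>s. bubble_weight t i s * ?K s)
      - integral ?I (\<lambda>s. left_weight t i s * ?K s)"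
    using assms by (simp add: integral_diff integral_add integrable_add integrable_weight_kernel)
  finally have "integral ?I (\<lambda>s. (1 + bubble_weight t i s - left_weight t i s) * ?K s)
    = integral ?I ?K + integral ?I (\<lambda>s. bubble_weight t i s * ?K s)
      - integral ?I (\<lambda>s. left_weight t i s * ?K s)" .
  moreover have "i - 1 < k" using assms by simp
  ultimately show ?thesis
    using assms c_coef_by_parts[of i k] c_coef_by_parts[of "i - 1" k] a_coef_by_parts[of i k]
      kernel_increment[of i k]
    by (simp add: excess_def d_coef_def numeral_2_eq_2)
qed

lemma excess_nonneg:
  assumes "1 \<le> i" "i < k"
  shows "0 \<le> excess \<alpha> t k i"
  using increasing_weight_inequality[OF assms(1) continuous_kernel_deriv kernel_deriv_mono
      kernel_deriv_nonneg, OF assms(2) assms(2)]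
  by (simp add: excess_eq_integral[OF assms])

text \<open>
  The weight inequality is applied to the difference of the kernel derivatives at two
  consecutive time levels, which is again nonnegative and increasing.
\<close>

lemma excess_antimono:
  assumes "1 \<le> i" "i < k"
  shows "excess \<alpha> t (k + 1) i \<le> excess \<alpha> t k i"
proof -
  let ?f = "\<lambda>s. kernel_deriv \<alpha> t k s - kernel_deriv \<alpha> t (k + 1) s"
  have k: "i < k + 1" using assms by simp
  note cont = continuous_kernel_deriv[OF assms(2)] continuous_kernel_deriv[OF k]
  have "integral {t (i - 2)..t (i - 1)} (\<lambda>s. bubble_weight t (i - 1) s * ?f s)
    \<le> integral {t (i - 1)..t i} (\<lambda>s. (1 + bubble_weight t i s - left_weight t i s) * ?f s)"
  proof (rule increasing_weight_inequality[OF assms(1) _ kernel_deriv_diff_mono[OF assms(2)]])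
    show "continuous_on {t (i - 2)..t i} ?f" by (intro continuous_intros cont)
    show "0 \<le> ?f s" if "s \<in> {t (i - 2)..t i}" for s
    proof -
      have "s < t k" using that t_less[OF assms(2)] by auto
      from kernel_deriv_antimono[OF this] show ?thesis by simp
    qed
  qed
  moreover have "integral {a..t m} (\<lambda>s. w s * ?f s)
      = integral {a..t m} (\<lambda>s. w s * kernel_deriv \<alpha> t k s) - integral {a..t m} (\<lambda>s. w s * kernel_deriv \<alpha> t (k + 1) s)"
    if "continuous_on {a..t m} w" "m \<le> i" for w a m
  proof -
    have "(\<lambda>s. w s * kernel_deriv \<alpha> t l s) integrable_on {a..t m}" if "m < l" for l
      using continuous_kernel_deriv[OF that] \<open>continuous_on {a..t m} w\<close>
      by (intro integrable_continuous_interval continuous_intros)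
    then show ?thesis using \<open>m \<le> i\<close> assms
      by (subst integral_diff[symmetric]) (auto simp: right_diff_distrib)
  qed
  ultimately show ?thesis
    unfolding excess_eq_integral[OF assms] excess_eq_integral[OF assms(1) k]
    by (simp add: continuous_intros)
qed

text \<open>
  For \<open>j = 1\<close> the left boundary term of the integration by parts has nothing to be
  compared with, and it takes the place of the excess.
\<close>

lemma d_coef_increment:
  assumes "1 \<le> j" "j < k"
  shows "d_coef \<alpha> t k j - d_coef \<alpha> t k (j - 1) = (if j = 1 then (t k - t 0) powr (- \<alpha>) else excess \<alpha> t k (j - 1))
    + integral {t (j - 1)..t j} (\<lambda>s. left_weight t j s * kernel_deriv \<alpha> t k s)"
  using assms a_coef_by_parts[OF assms] c_coef_0[of k \<alpha> t] d_coef_0[of k \<alpha> t]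
  by (auto simp: d_coef_def[of \<alpha> t k j] excess_def)

lemma d_coef_increment_nonneg:
  assumes "1 \<le> j" "j < k"
  shows "0 \<le> d_coef \<alpha> t k j - d_coef \<alpha> t k (j - 1)"
  unfolding d_coef_increment[OF assms]
  using left_integral_nonneg[OF assms] excess_nonneg[of "j - 1" k] assms
  by (cases "j = 1") (auto intro!: add_nonneg_nonneg)

lemma d_coef_increment_antimono:
  assumes "1 \<le> j" "j < k"
  shows "d_coef \<alpha> t (k + 1) j - d_coef \<alpha> t (k + 1) (j - 1) \<le> d_coef \<alpha> t k j - d_coef \<alpha> t k (j - 1)"
proof -
  have "(t (k + 1) - t 0) powr (- \<alpha>) \<le> (t k - t 0) powr (- \<alpha>)"
    using assms \<alpha> t_less[of 0 k] t_le[of k "k + 1"] by (intro powr_mono2') auto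
  moreover have "j < k + 1" using assms by simp
  ultimately show ?thesis
    unfolding d_coef_increment[OF assms] d_coef_increment[OF assms(1) \<open>j < k + 1\<close>]
    using left_integral_antimono[OF assms] excess_antimono[of "j - 1" k] assms
    by (cases "j = 1") (simp_all add: add_mono)
qed

section \<open>Closed forms of the coefficients\<close>

lemma step_powr:
  assumes "1 \<le> k"
  shows "step t k powr (1 - \<alpha>) = step t k * step t k powr (- \<alpha>)"
    and "step t k powr (2 - \<alpha>) = (step t k)\<^sup>2 * step t k powr (- \<alpha>)"
  using step_pos[OF assms] by (auto simp: powr_minus_divide powr_diff)

text \<open>
  The integrability is needed to split the integral of the interpolant's derivative over
  the interval where the kernel is singular.
\<close>

lemma a_coef_diag:
  assumes "2 \<le> k"
  shows "(1 - \<alpha>) * (2 - \<alpha>) * a_coef \<alpha> t k k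
    = \<alpha> * step t k powr (- \<alpha>) * ((ratio t k)\<^sup>2 / (1 + ratio t k))"
    and "(\<lambda>s. (2 * s - t (k - 1) - t k) / (step t (k - 1) * (step t (k - 1) + step t k)) * (1 / (t k - s) powr \<alpha>))
      integrable_on {t (k - 1)..t k}"
proof -
  define r where "r = step t (k - 1)"
  define \<rho> where "\<rho> = ratio t k"
  have r: "0 < r" using assms step_pos[of "k - 1"] by (simp add: r_def)
  have "1 \<le> k" using assms by simp
  note k1 = step_powr[OF this]
  have \<rho>: "0 < \<rho>" "step t k = \<rho> * r" using ratio_bounds[OF assms] by (auto simp: \<rho>_def r_def)
  define w where "w = step t k powr (- \<alpha>)"
  let ?D = "r * (r + step t k)"
  have *: "(2 * s - t (k - 1) - t k) / ?D = step t k / ?D + (- 2 / ?D) * (t k - s)" for s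
    by (simp add: step_def diff_divide_distrib add_divide_distrib)
  have I: "((\<lambda>s. (2 * s - t (k - 1) - t k) / ?D * (1 / (t k - s) powr \<alpha>)) has_integral
     (step t k / ?D / (1 - \<alpha>) * ((t k - t (k - 1)) powr (1 - \<alpha>) - (t k - t k) powr (1 - \<alpha>))
     + (- 2 / ?D) / (2 - \<alpha>) * ((t k - t (k - 1)) powr (2 - \<alpha>) - (t k - t k) powr (2 - \<alpha>)))) {t (k - 1)..t k}"
    unfolding * using \<alpha> by (intro has_integral_affine_kernel) (auto intro: t_le)
  show "(\<lambda>s. (2 * s - t (k - 1) - t k) / (step t (k - 1) * (step t (k - 1) + step t k)) * (1 / (t k - s) powr \<alpha>))
      integrable_on {t (k - 1)..t k}"
    using I unfolding r_def by (rule has_integral_integrable)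
  have "a_coef \<alpha> t k k = step t k / ?D / (1 - \<alpha>) * step t k powr (1 - \<alpha>)
      + (- 2 / ?D) / (2 - \<alpha>) * step t k powr (2 - \<alpha>)"
    unfolding a_coef_def using integral_unique[OF I] by (simp add: r_def step_def)
  also have "\<dots> = w * \<rho>\<^sup>2 / (1 + \<rho>) * (1 / (1 - \<alpha>) - 2 / (2 - \<alpha>))"
  proof -
    have gen: "h / D / p * (h * w) + (- 2 / D) / q * (h\<^sup>2 * w) = w * (h\<^sup>2 / D) * (1 / p - 2 / q)"
      for h D p q w :: real
      by (simp add: divide_inverse algebra_simps power2_eq_square)
    have "?D = r\<^sup>2 * (1 + \<rho>)" "(step t k)\<^sup>2 = r\<^sup>2 * \<rho>\<^sup>2"
      by (simp_all add: \<rho>(2) algebra_simps power2_eq_square)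
    then have "(step t k)\<^sup>2 / ?D = \<rho>\<^sup>2 / (1 + \<rho>)" using r by simp
    then show ?thesis unfolding k1 gen w_def by simp
  qed
  also have "1 / (1 - \<alpha>) - 2 / (2 - \<alpha>) = \<alpha> / ((1 - \<alpha>) * (2 - \<alpha>))"
    using \<alpha> by (simp add: divide_simps)
  finally show "(1 - \<alpha>) * (2 - \<alpha>) * a_coef \<alpha> t k k
    = \<alpha> * step t k powr (- \<alpha>) * ((ratio t k)\<^sup>2 / (1 + ratio t k))"
    using \<alpha> by (simp add: w_def[symmetric] \<rho>_def[symmetric])
qed

lemma c_coef_diag:
  assumes "2 \<le> k"
  shows "(1 - \<alpha>) * (2 - \<alpha>) * c_coef \<alpha> t k k = step t k powr (- \<alpha>) * (2 - \<alpha> / (1 + ratio t k))"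
    and "(\<lambda>s. (2 * s - t (k - 2) - t (k - 1)) / (step t k * (step t (k - 1) + step t k)) * (1 / (t k - s) powr \<alpha>))
      integrable_on {t (k - 1)..t k}"
proof -
  define r where "r = step t (k - 1)"
  define \<rho> where "\<rho> = ratio t k"
  have r: "0 < r" using assms step_pos[of "k - 1"] by (simp add: r_def)
  have "1 \<le> k" using assms by simp
  note k1 = step_powr[OF this]
  have \<rho>: "0 < \<rho>" "step t k = \<rho> * r" using ratio_bounds[OF assms] by (auto simp: \<rho>_def r_def)
  define w where "w = step t k powr (- \<alpha>)"
  let ?D = "step t k * (r + step t k)"
  have "t (k - 2) = t k - step t k - r" by (simp add: r_def step_def numeral_2_eq_2)
  then have *: "(2 * s - t (k - 2) - t (k - 1)) / ?D = (2 * step t k + r) / ?D + (- 2 / ?D) * (t k - s)" for s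
    by (simp add: t_eq[of k] diff_divide_distrib add_divide_distrib right_diff_distrib)
  have I: "((\<lambda>s. (2 * s - t (k - 2) - t (k - 1)) / ?D * (1 / (t k - s) powr \<alpha>)) has_integral
     ((2 * step t k + r) / ?D / (1 - \<alpha>) * ((t k - t (k - 1)) powr (1 - \<alpha>) - (t k - t k) powr (1 - \<alpha>))
     + (- 2 / ?D) / (2 - \<alpha>) * ((t k - t (k - 1)) powr (2 - \<alpha>) - (t k - t k) powr (2 - \<alpha>)))) {t (k - 1)..t k}"
    unfolding * using \<alpha> by (intro has_integral_affine_kernel) (auto intro: t_le)
  show "(\<lambda>s. (2 * s - t (k - 2) - t (k - 1)) / (step t k * (step t (k - 1) + step t k)) * (1 / (t k - s) powr \<alpha>))
      integrable_on {t (k - 1)..t k}"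
    using I unfolding r_def by (rule has_integral_integrable)
  have "c_coef \<alpha> t k k = (2 * step t k + r) / ?D / (1 - \<alpha>) * step t k powr (1 - \<alpha>)
      + (- 2 / ?D) / (2 - \<alpha>) * step t k powr (2 - \<alpha>)"
    unfolding c_coef_def using integral_unique[OF I] by (simp add: r_def step_def)
  also have "\<dots> = w * ((2 * \<rho> + 1) / (1 + \<rho>) / (1 - \<alpha>) - 2 * \<rho> / (1 + \<rho>) / (2 - \<alpha>))"
  proof -
    have gen: "g / D / p * (h * w) + (- 2 / D) / q * (h\<^sup>2 * w) = w * (g * h / D / p - 2 * h\<^sup>2 / D / q)"
      for g h D p q w :: real
      by (simp add: divide_inverse algebra_simps power2_eq_square)
    have "?D = r\<^sup>2 * \<rho> * (1 + \<rho>)" "2 * (step t k)\<^sup>2 = r\<^sup>2 * \<rho> * (2 * \<rho>)"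
      "(2 * step t k + r) * step t k = r\<^sup>2 * \<rho> * (2 * \<rho> + 1)"
      by (simp_all add: \<rho>(2) algebra_simps power2_eq_square)
    then have "2 * (step t k)\<^sup>2 / ?D = 2 * \<rho> / (1 + \<rho>)"
      "(2 * step t k + r) * step t k / ?D = (2 * \<rho> + 1) / (1 + \<rho>)" using r \<rho>(1) by simp_all
    then show ?thesis unfolding k1 gen w_def by simp
  qed
  also have "(1 - \<alpha>) * (2 - \<alpha>) * \<dots> = w * (2 - \<alpha> / (1 + \<rho>))"
    using \<alpha> \<rho> by (simp add: divide_simps) (simp add: algebra_simps)
  finally show "(1 - \<alpha>) * (2 - \<alpha>) * c_coef \<alpha> t k k = step t k powr (- \<alpha>) * (2 - \<alpha> / (1 + ratio t k))"
    by (simp add: w_def[symmetric] \<rho>_def[symmetric])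
qed

lemma a_coef_subdiag:
  assumes "1 \<le> k"
  defines "y \<equiv> ratio t (k + 1)"
  shows "(1 - \<alpha>) * (2 - \<alpha>) * - a_coef \<alpha> t (k + 1) k
    = step t k powr (- \<alpha>) * ((1 + y) powr (- \<alpha>) * (2 * (1 - \<alpha>) - \<alpha> * y) + \<alpha> * y powr (2 - \<alpha>) / (1 + y))"
proof -
  define r where "r = step t k"
  have r: "0 < r" using assms step_pos by (simp add: r_def)
  have y: "0 < y" "step t (k + 1) = y * r" using ratio_bounds[of "k + 1"] assms by (auto simp: r_def)
  define w where "w = r powr (- \<alpha>)"
  define v where "v = (1 + y) powr (- \<alpha>)"
  let ?D = "r * (r + y * r)"
  have nodes: "t k = t (k - 1) + r" "t (k + 1) = t (k - 1) + (r + y * r)"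
    using y by (auto simp: r_def step_def)
  have *: "(2 * s - t k - t (k + 1)) / ?D = y * r / ?D + (- 2 / ?D) * (t (k + 1) - s)" for s
  proof -
    have "2 * s - t k - t (k + 1) = y * r - 2 * (t (k + 1) - s)" using nodes by simp
    moreover have "(Y - 2 * X) / D = Y / D + (- 2 / D) * X" for X Y D :: real
      by (simp add: diff_divide_distrib)
    ultimately show ?thesis by (simp only:)
  qed
  have "((\<lambda>s. (2 * s - t k - t (k + 1)) / ?D * (1 / (t (k + 1) - s) powr \<alpha>)) has_integral
     (y * r / ?D / (1 - \<alpha>) * ((t (k + 1) - t (k - 1)) powr (1 - \<alpha>) - (t (k + 1) - t k) powr (1 - \<alpha>))
     + (- 2 / ?D) / (2 - \<alpha>) * ((t (k + 1) - t (k - 1)) powr (2 - \<alpha>) - (t (k + 1) - t k) powr (2 - \<alpha>)))) {t (k - 1)..t k}"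
    unfolding * using \<alpha> by (intro has_integral_affine_kernel) (auto intro: t_le)
  moreover have "t (k + 1) - t (k - 1) = r * (1 + y)" "t (k + 1) - t k = r * y"
    using nodes by (simp_all add: algebra_simps)
  moreover have "(r * (1 + y)) powr (1 - \<alpha>) = r * (1 + y) * (w * v)" "(r * (1 + y)) powr (2 - \<alpha>) = r\<^sup>2 * (1 + y)\<^sup>2 * (w * v)"
    "(r * y) powr (1 - \<alpha>) = r * w * (y powr (2 - \<alpha>) / y)" "(r * y) powr (2 - \<alpha>) = r\<^sup>2 * w * y powr (2 - \<alpha>)"
    using r y by (simp_all add: w_def v_def powr_mult powr_diff powr_minus_divide power2_eq_square)
  ultimately have "a_coef \<alpha> t (k + 1) k = y * r / ?D / (1 - \<alpha>) * (r * (1 + y) * (w * v) - r * w * (y powr (2 - \<alpha>) / y))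
     + (- 2 / ?D) / (2 - \<alpha>) * (r\<^sup>2 * (1 + y)\<^sup>2 * (w * v) - r\<^sup>2 * w * y powr (2 - \<alpha>))"
    using y by (simp add: a_coef_def r_def[symmetric] integral_unique)
  also have "\<dots> = w * ((1 / (1 + y)) * (y * (1 + y) * v - y powr (2 - \<alpha>)) / (1 - \<alpha>)
      - 2 * (1 / (1 + y)) * ((1 + y)\<^sup>2 * v - y powr (2 - \<alpha>)) / (2 - \<alpha>))"
  proof -
    have D: "1 / ?D = 1 / r\<^sup>2 * (1 / (1 + y))" by (simp add: power2_eq_square algebra_simps)
    define q where "q = 1 / (1 + y)"
    have 1: "y * r / ?D = y * r * (1 / r\<^sup>2 * q)" and 2: "- 2 / ?D = - 2 * (1 / r\<^sup>2 * q)"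
      unfolding q_def D[symmetric] by simp_all
    show ?thesis unfolding 1 2 unfolding q_def[symmetric] using r y \<alpha>
      by (simp add: divide_simps) (simp add: algebra_simps power2_eq_square)
  qed
  also have "(1 - \<alpha>) * (2 - \<alpha>) * - \<dots> = w * (v * (2 * (1 - \<alpha>) - \<alpha> * y) + \<alpha> * y powr (2 - \<alpha>) / (1 + y))"
    using \<alpha> y by (simp add: divide_simps) (simp add: algebra_simps power2_eq_square)
  finally show ?thesis by (simp add: w_def v_def r_def)
qed

end

section \<open>Quadratic forms\<close>

text \<open>
  If \<open>A = p - lam\<close> and \<open>B = q - lam\<close>, then \<open>A\<close> and \<open>B\<close> are nonnegative and \<open>A B = r\<^sup>2\<close>, so
  that \<open>A x\<^sup>2 + 2 r x y + B y\<^sup>2\<close> is a square.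
\<close>

lemma min_eigenvalue_form:
  fixes p q r x y :: real
  defines "lam \<equiv> (p + q - sqrt ((p - q)\<^sup>2 + 4 * r * r)) / 2"
  shows "lam * (x\<^sup>2 + y\<^sup>2) \<le> p * x\<^sup>2 + 2 * r * x * y + q * y\<^sup>2"
proof -
  define S where "S = sqrt ((p - q)\<^sup>2 + 4 * r * r)"
  have S2: "S\<^sup>2 = (p - q)\<^sup>2 + 4 * r * r" by (simp add: S_def)
  have "\<bar>p - q\<bar> \<le> S" unfolding S_def by (rule real_le_rsqrt) simp
  define A where "A = p - lam"
  define B where "B = q - lam"
  have AB: "0 \<le> A" "0 \<le> B"
    using \<open>\<bar>p - q\<bar> \<le> S\<close> by (auto simp: A_def B_def lam_def S_def[symmetric])
  have "A = (S + (p - q)) / 2" "B = (S - (p - q)) / 2"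
    unfolding A_def B_def lam_def S_def[symmetric] by (simp_all add: field_simps)
  then have "A * B = (S + (p - q)) / 2 * ((S - (p - q)) / 2)" by (simp only:)
  also have "\<dots> = (S + (p - q)) * (S - (p - q)) / 4" by simp
  also have "(S + (p - q)) * (S - (p - q)) = S\<^sup>2 - (p - q)\<^sup>2"
    by (simp add: algebra_simps power2_eq_square)
  also have "\<dots> / 4 = r\<^sup>2" using S2 by (simp add: power2_eq_square)
  finally have "(sqrt A * sqrt B)\<^sup>2 = r\<^sup>2" using AB by (simp add: power_mult_distrib)
  then have "\<bar>r\<bar> = sqrt A * sqrt B"
    using AB by (metis abs_of_nonneg mult_nonneg_nonneg power2_eq_iff_nonneg real_sqrt_ge_zero abs_ge_zero power2_abs)
  then have "\<bar>2 * r * x * y\<bar> = 2 * (sqrt A * \<bar>x\<bar>) * (sqrt B * \<bar>y\<bar>)" by (simp add: abs_mult)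
  also have "\<dots> \<le> (sqrt A * \<bar>x\<bar>)\<^sup>2 + (sqrt B * \<bar>y\<bar>)\<^sup>2" by (rule sum_squares_bound)
  also have "\<dots> = A * x\<^sup>2 + B * y\<^sup>2" using AB by (simp add: power_mult_distrib)
  finally have "0 \<le> A * x\<^sup>2 + B * y\<^sup>2 + 2 * r * x * y" by linarith
  then show ?thesis by (simp add: A_def B_def algebra_simps)
qed

lemma min_eigenvalue_ge:
  fixes p q r m :: real
  assumes "m \<le> p - \<bar>r\<bar>" "m \<le> q - \<bar>r\<bar>"
  shows "m \<le> (p + q - sqrt ((p - q)\<^sup>2 + 4 * r * r)) / 2"
proof -
  have "sqrt ((p - q)\<^sup>2 + 4 * r * r) \<le> \<bar>p - q\<bar> + 2 * \<bar>r\<bar>"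
  proof (rule real_le_lsqrt)
    have "(\<bar>p - q\<bar> + 2 * \<bar>r\<bar>)\<^sup>2 = (p - q)\<^sup>2 + 4 * r * r + 4 * (\<bar>p - q\<bar> * \<bar>r\<bar>)"
      by (simp add: power2_sum power_mult_distrib) (simp add: power2_eq_square)
    then show "(p - q)\<^sup>2 + 4 * r * r \<le> (\<bar>p - q\<bar> + 2 * \<bar>r\<bar>)\<^sup>2" by simp
  qed simp
  then show ?thesis using assms by (simp add: abs_if split: if_splits)
qed

text \<open>
  Let \<open>e j = D (n + 1) j - D (n + 1) (j - 1)\<close> and \<open>S j = y j + \<dots> + y n\<close>. The sum of \<open>e j\<close>
  over \<open>j\<close> is \<open>D (n + 1) n\<close>, and the sum of \<open>e j * S j\<close> is that of \<open>D (n + 1) j * y j\<close>.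
  Hence the terms which row \<open>n + 1\<close> contributes are just those that turn each \<open>(S j)\<^sup>2\<close>
  into \<open>(S j + y (n + 1))\<^sup>2\<close>, with weight \<open>e j\<close>. The squares from row \<open>n\<close> are available
  for this as their weights are at least \<open>e j\<close>.
\<close>

lemma quadratic_form_ge_squares:
  fixes D :: "nat \<Rightarrow> nat \<Rightarrow> real" and y :: "nat \<Rightarrow> real"
  assumes "1 \<le> n" and D0: "\<And>k. 1 \<le> k \<Longrightarrow> D k 0 = 0"
    and antimono: "\<And>j k. 1 \<le> j \<Longrightarrow> j < k \<Longrightarrow> D (k + 1) j - D (k + 1) (j - 1) \<le> D k j - D k (j - 1)"
  shows "(\<Sum>j = 1..n - 1. (D n j - D n (j - 1)) * (\<Sum>i = j..n. y i)\<^sup>2)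
    \<le> 2 * (\<Sum>k = 1..n. y k * (\<Sum>j = 1..k - 1. D k j * y j))
      + (\<Sum>k = 1..n - 1. (D (k + 1) k - D (k + 1) (k - 1) + D k (k - 1)) * (y k)\<^sup>2)
      + D n (n - 1) * (y n)\<^sup>2"
  using \<open>1 \<le> n\<close>
proof (induction n rule: nat_induct_at_least)
  case base
  then show ?case by (simp add: D0)
next
  case (Suc n)
  define S where "S = (\<lambda>j. \<Sum>i = j..n. y i)"
  define e where "e = (\<lambda>j. D (n + 1) j - D (n + 1) (j - 1))"
  define z where "z = y (n + 1)"
  obtain m where n: "n = Suc m" using Suc.hyps by (cases n) auto
  have S_Suc: "(\<Sum>i = j..Suc n. y i) = S j + z" if "j \<le> n" for j
    using that by (simp add: S_def z_def)
  have telescope: "(\<Sum>j = 1..l. e j) = D (n + 1) l" for l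
    by (induction l) (simp_all add: e_def D0)
  have abel: "(\<Sum>j = 1..n. e j * S j) = (\<Sum>j = 1..n. D (n + 1) j * y j)"
  proof -
    have "(\<Sum>j = 1..l. e j * (\<Sum>i = j..l. y i)) = (\<Sum>j = 1..l. D (n + 1) j * y j)" for l
    proof (induction l)
      case (Suc l)
      have "(\<Sum>j = 1..Suc l. e j * (\<Sum>i = j..Suc l. y i))
          = (\<Sum>j = 1..l. e j * ((\<Sum>i = j..l. y i) + y (Suc l))) + e (Suc l) * y (Suc l)"
        by simp
      also have "(\<Sum>j = 1..l. e j * ((\<Sum>i = j..l. y i) + y (Suc l)))
          = (\<Sum>j = 1..l. D (n + 1) j * y j) + (\<Sum>j = 1..l. e j) * y (Suc l)"
        unfolding distrib_left sum.distrib Suc.IH sum_distrib_right ..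
      finally show ?case using telescope[of l] by (simp add: e_def algebra_simps)
    qed simp
    then show ?thesis by (simp add: S_def)
  qed
  have "(\<Sum>j = 1..n. e j * (S j)\<^sup>2) = (\<Sum>j = 1..n - 1. e j * (S j)\<^sup>2) + e n * (y n)\<^sup>2"
    using n by (simp add: S_def)
  moreover have "(\<Sum>j = 1..n - 1. e j * (S j)\<^sup>2) \<le> (\<Sum>j = 1..n - 1. (D n j - D n (j - 1)) * (S j)\<^sup>2)"
    unfolding e_def by (intro sum_mono mult_right_mono antimono) auto
  moreover have "(\<Sum>k = 1..n - 1. (D (k + 1) k - D (k + 1) (k - 1) + D k (k - 1)) * (y k)\<^sup>2)
      + D n (n - 1) * (y n)\<^sup>2 + e n * (y n)\<^sup>2
    = (\<Sum>k = 1..n. (D (k + 1) k - D (k + 1) (k - 1) + D k (k - 1)) * (y k)\<^sup>2)"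
    using n by (simp add: e_def algebra_simps)
  ultimately have IH: "(\<Sum>j = 1..n. e j * (S j)\<^sup>2) \<le> 2 * (\<Sum>k = 1..n. y k * (\<Sum>j = 1..k - 1. D k j * y j))
      + (\<Sum>k = 1..n. (D (k + 1) k - D (k + 1) (k - 1) + D k (k - 1)) * (y k)\<^sup>2)"
    using Suc.IH unfolding S_def by linarith
  have "(\<Sum>j = 1..Suc n - 1. (D (Suc n) j - D (Suc n) (j - 1)) * (\<Sum>i = j..Suc n. y i)\<^sup>2)
      = (\<Sum>j = 1..n. e j * (S j + z)\<^sup>2)"
  proof (intro sum.cong)
    fix j assume "j \<in> {1..n}"
    then show "(D (Suc n) j - D (Suc n) (j - 1)) * (\<Sum>i = j..Suc n. y i)\<^sup>2 = e j * (S j + z)\<^sup>2"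
      using S_Suc[of j] by (simp only: e_def Suc_eq_plus1 atLeastAtMost_iff)
  qed simp
  also have "\<dots> = (\<Sum>j = 1..n. e j * (S j)\<^sup>2 + 2 * z * (e j * S j) + z\<^sup>2 * e j)"
    by (simp add: power2_sum algebra_simps)
  also have "\<dots> = (\<Sum>j = 1..n. e j * (S j)\<^sup>2) + 2 * z * (\<Sum>j = 1..n. e j * S j) + z\<^sup>2 * (\<Sum>j = 1..n. e j)"
    by (simp only: sum.distrib sum_distrib_left)
  finally show ?case
    using IH unfolding abel telescope by (simp add: z_def algebra_simps)
qed

section \<open>Lower bounds for the diagonal\<close>

context graded_mesh
begin

lemma a_coef_diag_nonneg:
  assumes "2 \<le> k"
  shows "0 \<le> a_coef \<alpha> t k k"
proof -
  have "0 \<le> (1 - \<alpha>) * (2 - \<alpha>) * a_coef \<alpha> t k k"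
    unfolding a_coef_diag(1)[OF assms] using \<alpha> ratio_bounds(3)[OF assms] by simp
  moreover have "0 < (1 - \<alpha>) * (2 - \<alpha>)" using \<alpha> by simp
  ultimately show ?thesis by (simp add: zero_le_mult_iff)
qed

text \<open>
  The left-hand side is the closed form of
  $2c_k^{(k)} - a_k^{(k)} - a_{k+1}^{(k+1)} + a_k^{(k+1)} - \tau_k^{-\alpha} + (\tau_k + \tau_{k+1})^{-\alpha}$,
  multiplied by \<open>(1 - \<alpha>) (2 - \<alpha>)\<close>. Apart from this factor, the two sides differ by
  $c_{k-1}^{(k)}$ and by the decrease of the excess from time level \<open>k\<close> to \<open>k + 1\<close>,
  neither of which is negative.
\<close>

lemma interior_diagonal_ge:
  assumes "2 \<le> k"
  defines "x \<equiv> ratio t k" and "y \<equiv> ratio t (k + 1)"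
  shows "\<alpha> / step t k powr \<alpha> * ((1 + \<alpha>) * (2 - \<alpha>) / \<alpha> + (y - 1 + \<alpha>) / (1 + y) powr \<alpha>
          - 2 * y powr (2 - \<alpha>) / (1 + y) - x * (x - 2) / (1 + x))
    \<le> (1 - \<alpha>) * (2 - \<alpha>) * (2 * c_coef \<alpha> t k k + 2 * c_coef \<alpha> t k (k - 1) - square_coef \<alpha> t k
          - a_coef \<alpha> t k k - a_coef \<alpha> t (k + 1) (k + 1))"
proof -
  define \<kappa> where "\<kappa> = (1 - \<alpha>) * (2 - \<alpha>)"
  define w where "w = step t k powr (- \<alpha>)"
  define v where "v = (1 + y) powr (- \<alpha>)"
  have \<kappa>: "0 < \<kappa>" using \<alpha> by (simp add: \<kappa>_def)
  have k: "1 \<le> k - 1" "k - 1 < k" "1 \<le> k" "2 \<le> k + 1" using assms by auto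
  have x: "0 < x" "step t k = x * step t (k - 1)" using ratio_bounds[OF assms(1)] by (auto simp: x_def)
  have y: "0 < y" "step t (k + 1) = y * step t k" using ratio_bounds[of "k + 1"] assms(1) by (auto simp: y_def)
  have \<tau>: "0 < step t k" using step_pos k by simp
  have nodes: "t k - t (k - 1) = step t k" "t (k + 1) - t (k - 1) = step t k * (1 + y)"
    using y(2) by (auto simp: step_def algebra_simps)
  have "(t (k + 1) - t (k - 1)) powr (- \<alpha>) = w * v"
    unfolding nodes w_def v_def using \<tau> y(1) by (simp add: powr_mult)
  moreover have "excess \<alpha> t (k + 1) (k - 1) \<le> excess \<alpha> t k (k - 1)"
    using excess_antimono k by simp
  moreover have "0 \<le> c_coef \<alpha> t k (k - 1)" using c_coef_nonneg k by simp
  ultimately have "a_coef \<alpha> t (k + 1) k - w + w * v \<le> 2 * c_coef \<alpha> t k (k - 1) - square_coef \<alpha> t k"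
    unfolding excess_def nodes(1) w_def[symmetric] square_coef_def
    by (simp add: d_coef_def[of \<alpha> t "k + 1" k] del: One_nat_def)
  then have "\<kappa> * (a_coef \<alpha> t (k + 1) k - w + w * v) \<le> \<kappa> * (2 * c_coef \<alpha> t k (k - 1) - square_coef \<alpha> t k)"
    using \<kappa> by (intro mult_left_mono) auto
  moreover have "\<kappa> * c_coef \<alpha> t k k = w * (2 - \<alpha> / (1 + x))"
    using c_coef_diag(1)[OF assms(1)] by (simp add: \<kappa>_def w_def x_def)
  moreover have "\<kappa> * a_coef \<alpha> t k k = \<alpha> * w * (x\<^sup>2 / (1 + x))"
    using a_coef_diag(1)[OF assms(1)] by (simp add: \<kappa>_def w_def x_def)
  moreover have "\<kappa> * a_coef \<alpha> t (k + 1) (k + 1) = \<alpha> * w * (y powr (2 - \<alpha>) / (1 + y))"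
  proof -
    have "step t (k + 1) powr (- \<alpha>) = w * y powr (- \<alpha>)"
      unfolding y(2) w_def using y \<tau> by (simp add: powr_mult)
    moreover have "y powr (2 - \<alpha>) = y\<^sup>2 * y powr (- \<alpha>)" using y by (simp add: powr_diff powr_minus_divide)
    ultimately show ?thesis
      using a_coef_diag(1)[OF k(4)] by (simp add: \<kappa>_def y_def)
  qed
  moreover have "\<kappa> * a_coef \<alpha> t (k + 1) k
      = - w * (v * (2 * (1 - \<alpha>) - \<alpha> * y) + \<alpha> * y powr (2 - \<alpha>) / (1 + y))"
    using a_coef_subdiag[OF k(3)] by (simp add: \<kappa>_def y_def w_def v_def)
  moreover have "\<alpha> / step t k powr \<alpha> * ((1 + \<alpha>) * (2 - \<alpha>) / \<alpha> + (y - 1 + \<alpha>) / (1 + y) powr \<alpha>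
          - 2 * y powr (2 - \<alpha>) / (1 + y) - x * (x - 2) / (1 + x))
     = 2 * (w * (2 - \<alpha> / (1 + x))) - \<alpha> * w * (x\<^sup>2 / (1 + x)) - \<alpha> * w * (y powr (2 - \<alpha>) / (1 + y))
       - w * (v * (2 * (1 - \<alpha>) - \<alpha> * y) + \<alpha> * y powr (2 - \<alpha>) / (1 + y)) - \<kappa> * w + \<kappa> * w * v"
  proof -
    define P where "P = y powr (2 - \<alpha>) / (1 + y)"
    have X: "x * (x - 2) / (1 + x) = x\<^sup>2 / (1 + x) - 2 + 2 / (1 + x)"
      using x(1) by (simp add: divide_simps) (simp add: algebra_simps power2_eq_square)
    have 1: "\<alpha> / step t k powr \<alpha> = \<alpha> * w" "(y - 1 + \<alpha>) / (1 + y) powr \<alpha> = (y - 1 + \<alpha>) * v"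
      by (simp_all add: w_def v_def powr_minus_divide)
    have 2: "\<alpha> * w * (N / \<alpha> + Z - Z' - Z'') = w * N + \<alpha> * w * Z - \<alpha> * w * Z' - \<alpha> * w * Z''" for N Z Z' Z''
      using \<alpha> by (simp add: algebra_simps)
    have 3: "\<alpha> / (1 + x) = \<alpha> * (1 / (1 + x))" "2 / (1 + x) = 2 * (1 / (1 + x))"
      "2 * y powr (2 - \<alpha>) / (1 + y) = 2 * P" "\<alpha> * y powr (2 - \<alpha>) / (1 + y) = \<alpha> * P" by (simp_all add: P_def)
    define X1 where "X1 = x\<^sup>2 / (1 + x)"
    define X2 where "X2 = 1 / (1 + x)"
    show ?thesis unfolding 1 2 X 3 P_def[symmetric] X1_def[symmetric] X2_def[symmetric] \<kappa>_def
      by (simp add: algebra_simps)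
  qed
  moreover have "\<kappa> * (b - w + w * v) = \<kappa> * b - \<kappa> * w + \<kappa> * w * v"
    "\<kappa> * (2 * c + 2 * c' - s - a - a') = 2 * (\<kappa> * c) + \<kappa> * (2 * c' - s) - \<kappa> * a - \<kappa> * a'" for a a' b c c' s
    by (simp_all add: algebra_simps)
  ultimately show ?thesis unfolding \<kappa>_def[symmetric] by argo
qed

text \<open>
  In the last row there is no later time level. The left-hand side is the closed form of
  $2c_k^{(k)} - a_k^{(k)} - \tau_k^{-\alpha}$, and the excess itself replaces its
  decrease.
\<close>

lemma last_diagonal_ge:
  assumes "2 \<le> k"
  defines "x \<equiv> ratio t k"
  shows "\<alpha> / step t k powr \<alpha> * ((1 + \<alpha>) * (2 - \<alpha>) / \<alpha> - x * (x - 2) / (1 + x))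
    \<le> (1 - \<alpha>) * (2 - \<alpha>) * (2 * c_coef \<alpha> t k k + 2 * c_coef \<alpha> t k (k - 1) - d_coef \<alpha> t k (k - 1) - a_coef \<alpha> t k k)"
proof -
  define \<kappa> where "\<kappa> = (1 - \<alpha>) * (2 - \<alpha>)"
  define w where "w = step t k powr (- \<alpha>)"
  have \<kappa>: "0 < \<kappa>" using \<alpha> by (simp add: \<kappa>_def)
  have k: "1 \<le> k - 1" "k - 1 < k" using assms by auto
  have x: "0 < x" using ratio_bounds[OF assms(1)] by (auto simp: x_def)
  have nodes: "t k - t (k - 1) = step t k" by (simp add: step_def)
  have "0 \<le> excess \<alpha> t k (k - 1)" using excess_nonneg k by simp
  moreover have "0 \<le> c_coef \<alpha> t k (k - 1)" using c_coef_nonneg k by simp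
  ultimately have "- w \<le> 2 * c_coef \<alpha> t k (k - 1) - d_coef \<alpha> t k (k - 1)"
    unfolding excess_def nodes(1) w_def[symmetric] by simp
  then have "\<kappa> * (- w) \<le> \<kappa> * (2 * c_coef \<alpha> t k (k - 1) - d_coef \<alpha> t k (k - 1))"
    using \<kappa> by (intro mult_left_mono) auto
  moreover have "\<kappa> * c_coef \<alpha> t k k = w * (2 - \<alpha> / (1 + x))"
    using c_coef_diag(1)[OF assms(1)] by (simp add: \<kappa>_def w_def x_def)
  moreover have "\<kappa> * a_coef \<alpha> t k k = \<alpha> * w * (x\<^sup>2 / (1 + x))"
    using a_coef_diag(1)[OF assms(1)] by (simp add: \<kappa>_def w_def x_def)
  moreover have "\<alpha> / step t k powr \<alpha> * ((1 + \<alpha>) * (2 - \<alpha>) / \<alpha> - x * (x - 2) / (1 + x))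
     = 2 * (w * (2 - \<alpha> / (1 + x))) - \<alpha> * w * (x\<^sup>2 / (1 + x)) - \<kappa> * w"
  proof -
    have X: "x * (x - 2) / (1 + x) = x\<^sup>2 / (1 + x) - 2 + 2 / (1 + x)"
      using x(1) by (simp add: divide_simps) (simp add: algebra_simps power2_eq_square)
    have 1: "\<alpha> / step t k powr \<alpha> = \<alpha> * w" by (simp_all add: w_def powr_minus_divide)
    have 2: "\<alpha> * w * (N / \<alpha> - Z) = w * N - \<alpha> * w * Z" for N Z
      using \<alpha> by (simp add: right_diff_distrib)
    have 3: "\<alpha> / (1 + x) = \<alpha> * (1 / (1 + x))" "2 / (1 + x) = 2 * (1 / (1 + x))" by simp_all
    show ?thesis unfolding 1 2 X 3 \<kappa>_def by (simp only: algebra_simps)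
  qed
  moreover have "\<kappa> * (2 * c + 2 * c' - d - a) = 2 * (\<kappa> * c) + \<kappa> * (2 * c' - d) - \<kappa> * a" for a c c' d
    by (simp add: algebra_simps)
  ultimately show ?thesis unfolding \<kappa>_def[symmetric] by (simp only:)
qed

end

section \<open>Products of square integrable functions\<close>

lemma square_integrable_diff:
  assumes "square_integrable M f" "square_integrable M g"
  shows "square_integrable M (\<lambda>x. f x - g x)"
proof -
  have [measurable]: "f \<in> borel_measurable M" "g \<in> borel_measurable M"
    using assms by (auto simp: square_integrable_def)
  have "integrable M (\<lambda>x. (f x - g x)\<^sup>2)"
  proof (rule Bochner_Integration.integrable_bound)
    show "integrable M (\<lambda>x. 2 * (f x)\<^sup>2 + 2 * (g x)\<^sup>2)"
      using assms by (simp add: square_integrable_def)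
    show "(\<lambda>x. (f x - g x)\<^sup>2) \<in> borel_measurable M" by measurable
    show "AE x in M. norm ((f x - g x)\<^sup>2) \<le> norm (2 * (f x)\<^sup>2 + 2 * (g x)\<^sup>2)"
    proof (rule AE_I2)
      fix x
      have "0 \<le> (f x + g x)\<^sup>2" by simp
      then have "(f x - g x)\<^sup>2 \<le> 2 * (f x)\<^sup>2 + 2 * (g x)\<^sup>2" by (simp add: power2_sum power2_diff)
      then show "norm ((f x - g x)\<^sup>2) \<le> norm (2 * (f x)\<^sup>2 + 2 * (g x)\<^sup>2)" by simp
    qed
  qed
  then show ?thesis using assms by (simp add: square_integrable_def)
qed

lemma square_integrable_mult:
  assumes "square_integrable M f" "square_integrable M g"
  shows "integrable M (\<lambda>x. f x * g x)"
proof (rule Bochner_Integration.integrable_bound)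
  show "integrable M (\<lambda>x. (f x)\<^sup>2 + (g x)\<^sup>2)"
    using assms by (simp add: square_integrable_def)
  show "(\<lambda>x. f x * g x) \<in> borel_measurable M"
    using assms by (auto simp: square_integrable_def)
  show "AE x in M. norm (f x * g x) \<le> norm ((f x)\<^sup>2 + (g x)\<^sup>2)"
  proof (rule AE_I2)
    fix x
    have "2 * \<bar>f x\<bar> * \<bar>g x\<bar> \<le> \<bar>f x\<bar>\<^sup>2 + \<bar>g x\<bar>\<^sup>2" by (rule sum_squares_bound)
    moreover have "0 \<le> \<bar>f x\<bar> * \<bar>g x\<bar>" by simp
    ultimately have "\<bar>f x\<bar> * \<bar>g x\<bar> \<le> (f x)\<^sup>2 + (g x)\<^sup>2" unfolding power2_abs by linarith
    then show "norm (f x * g x) \<le> norm ((f x)\<^sup>2 + (g x)\<^sup>2)" by (simp add: abs_mult)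
  qed
qed

section \<open>The quadratic form of the operator\<close>

context graded_mesh
begin

lemma C_mat_entries:
  "C_mat \<alpha> t $ 1 $ 1 = 2 / ((1 - \<alpha>) * step t 1 powr \<alpha>) + a_coef \<alpha> t 2 1"
  "C_mat \<alpha> t $ 1 $ 2 = - a_coef \<alpha> t 2 2" "C_mat \<alpha> t $ 2 $ 1 = - a_coef \<alpha> t 2 2"
  "C_mat \<alpha> t $ 2 $ 2 = 2 * c_coef \<alpha> t 2 1 + 2 * c_coef \<alpha> t 2 2 - square_coef \<alpha> t 2 - a_coef \<alpha> t 3 3"
  by (simp_all add: C_mat_def beta1_def beta2_def square_coef_def d_coef_def d23_def c_coef_0 field_simps
      numeral_2_eq_2 numeral_3_eq_3)

lemma g_coef_start:
  assumes "k \<le> 2"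
  shows "g_coef \<alpha> t n k = (1 - \<alpha>) * (2 - \<alpha>) *
    ((C_mat \<alpha> t $ 1 $ 1 + C_mat \<alpha> t $ 2 $ 2
      - sqrt ((C_mat \<alpha> t $ 1 $ 1 - C_mat \<alpha> t $ 2 $ 2)\<^sup>2 + 4 * (- a_coef \<alpha> t 2 2) * (- a_coef \<alpha> t 2 2))) / 2)"
  using assms step_pos[of 1] by (simp add: g_coef_def g_hat_def Let_def C_mat_entries(2,3))

lemma start_form_ge:
  assumes "k \<le> 2"
  shows "g_coef \<alpha> t n k * (x\<^sup>2 + y\<^sup>2) \<le> (1 - \<alpha>) * (2 - \<alpha>) *
    (C_mat \<alpha> t $ 1 $ 1 * x\<^sup>2 - 2 * a_coef \<alpha> t 2 2 * x * y + C_mat \<alpha> t $ 2 $ 2 * y\<^sup>2)"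
  unfolding g_coef_start[OF assms] mult.assoc[of _ _ "x\<^sup>2 + y\<^sup>2"]
  using min_eigenvalue_form[of "C_mat \<alpha> t $ 1 $ 1" "C_mat \<alpha> t $ 2 $ 2" "- a_coef \<alpha> t 2 2" x y] \<alpha>
  by (intro mult_left_mono) (simp_all only: mult_minus_left mult_minus_right minus_mult_minus, simp_all)

lemma g_coef_last:
  assumes "3 \<le> n"
  shows "g_coef \<alpha> t n n \<le> (1 - \<alpha>) * (2 - \<alpha>) *
    (2 * c_coef \<alpha> t n n + 2 * c_coef \<alpha> t n (n - 1) - d_coef \<alpha> t n (n - 1) - a_coef \<alpha> t n n)"
  using last_diagonal_ge[of n] assms by (simp add: g_coef_def)

lemma g_coef_interior:
  assumes "3 \<le> k" "k < n"
  shows "g_coef \<alpha> t n k \<le> (1 - \<alpha>) * (2 - \<alpha>) * (2 * c_coef \<alpha> t k k + 2 * c_coef \<alpha> t k (k - 1)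
      - square_coef \<alpha> t k - a_coef \<alpha> t k k - a_coef \<alpha> t (k + 1) (k + 1))"
  using interior_diagonal_ge[of k] assms by (simp add: g_coef_def)

text \<open>
  For \<open>k \<ge> 3\<close> each mixed term \<open>2 a y (k - 1) y k\<close> is shared equally between the two
  squares; the first two variables keep their exact quadratic form, which is that of the
  matrix \<open>C_mat\<close>. In the sum on the left the coefficient of \<open>(y n)\<^sup>2\<close> is already reduced
  by what row \<open>n + 1\<close> will take from it, and the last term on the left gives this back.
\<close>

lemma tridiagonal_form_ge:
  fixes y :: "nat \<Rightarrow> real"
  assumes "2 \<le> n"
  shows "C_mat \<alpha> t $ 1 $ 1 * (y 1)\<^sup>2 - 2 * a_coef \<alpha> t 2 2 * y 1 * y 2 + C_mat \<alpha> t $ 2 $ 2 * (y 2)\<^sup>2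
      + (\<Sum>k = 3..n. (2 * c_coef \<alpha> t k k + 2 * c_coef \<alpha> t k (k - 1)
           - square_coef \<alpha> t k - a_coef \<alpha> t k k - a_coef \<alpha> t (k + 1) (k + 1)) * (y k)\<^sup>2)
      + (square_coef \<alpha> t n + a_coef \<alpha> t (n + 1) (n + 1)) * (y n)\<^sup>2
    \<le> 2 / ((1 - \<alpha>) * step t 1 powr \<alpha>) * (y 1)\<^sup>2
      + (\<Sum>k = 2..n. 2 * (c_coef \<alpha> t k k + c_coef \<alpha> t k (k - 1)) * (y k)\<^sup>2 - 2 * a_coef \<alpha> t k k * y (k - 1) * y k)
      - (\<Sum>k = 1..n - 1. square_coef \<alpha> t k * (y k)\<^sup>2)"
  using assms
proof (induction n rule: nat_induct_at_least)
  case base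
  have "square_coef \<alpha> t 1 = - a_coef \<alpha> t 2 1"
    by (simp add: square_coef_def d_coef_0 d_coef_def[of \<alpha> t "Suc (Suc 0)" "Suc 0"] c_coef_0 numeral_2_eq_2)
  then show ?case by (simp add: C_mat_entries algebra_simps numeral_3_eq_3)
next
  case (Suc n)
  obtain m where n: "n = Suc (Suc m)" using Suc.hyps by (metis Suc_le_D numeral_2_eq_2 Suc_le_mono)
  have "2 * (y n * y (n + 1)) \<le> (y n)\<^sup>2 + (y (n + 1))\<^sup>2"
    using sum_squares_bound[of "y n" "y (n + 1)"] by (simp add: mult.assoc)
  then have "a_coef \<alpha> t (n + 1) (n + 1) * (2 * (y n * y (n + 1)))
      \<le> a_coef \<alpha> t (n + 1) (n + 1) * ((y n)\<^sup>2 + (y (n + 1))\<^sup>2)"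
    using Suc.hyps by (intro mult_left_mono a_coef_diag_nonneg) auto
  then show ?case using Suc.IH n by (simp add: algebra_simps)
qed

text \<open>
  The derivative of the interpolating polynomial is a combination of the two increments
  next to the node \<open>t j\<close>, with the factors that define \<open>a_coef\<close> and \<open>c_coef\<close>; the terms
  with the latter move by one index.
\<close>

lemma L2_op_eq:
  fixes v :: "nat \<Rightarrow> real"
  assumes "2 \<le> k"
  defines "y \<equiv> \<lambda>j. v j - v (j - 1)"
  shows "Gamma (1 - \<alpha>) * L2_op \<alpha> t k v = (c_coef \<alpha> t k k + c_coef \<alpha> t k (k - 1)) * y k
      - a_coef \<alpha> t k k * y (k - 1) + (\<Sum>j = 1..k - 1. d_coef \<alpha> t k j * y j)"
proof -
  have deriv_H2: "deriv (H2 t v j) s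
     = y (j + 1) * ((2 * s - t (j - 1) - t j) / (step t (j + 1) * (step t j + step t (j + 1))))
       - y j * ((2 * s - t j - t (j + 1)) / (step t j * (step t j + step t (j + 1))))" if "1 \<le> j" for j s
  proof (rule DERIV_imp_deriv)
    define h where "h = step t j"
    define l where "l = step t (j + 1)"
    have hl: "0 < h" "0 < l" using that step_pos by (auto simp: h_def l_def)
    have nodes: "t j = t (j - 1) + h" "t (j + 1) = t (j - 1) + h + l" by (auto simp: h_def l_def step_def)
    define s0 where "s0 = t (j - 1)"
    have dens: "(s0 - (s0 + h)) * (s0 - (s0 + h + l)) = h * (h + l)"
      "(s0 + h - s0) * (s0 + h - (s0 + h + l)) = - (h * l)"
      "(s0 + h + l - s0) * (s0 + h + l - (s0 + h)) = l * (h + l)"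
      by (simp_all add: algebra_simps)
    have H: "H2 t v j = (\<lambda>s. v (j - 1) / (h * (h + l)) * ((s - (s0 + h)) * (s - (s0 + h + l)))
       - v j / (h * l) * ((s - s0) * (s - (s0 + h + l)))
       + v (j + 1) / (l * (h + l)) * ((s - s0) * (s - (s0 + h))))"
      unfolding H2_def nodes s0_def[symmetric] dens by (simp only: times_divide_eq_left divide_minus_right diff_conv_add_uminus)
    have quadratic: "((\<lambda>s. p * ((s - (s0 + h)) * (s - (s0 + h + l))) - q * ((s - s0) * (s - (s0 + h + l)))
        + r * ((s - s0) * (s - (s0 + h)))) has_real_derivative
      p * (2 * s - 2 * s0 - 2 * h - l) - q * (2 * s - 2 * s0 - h - l) + r * (2 * s - 2 * s0 - h)) (at s)" for p q r
      by (auto intro!: derivative_eq_intros simp: algebra_simps)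
    have "(H2 t v j has_real_derivative v (j - 1) / (h * (h + l)) * (2 * s - 2 * s0 - 2 * h - l)
       - v j / (h * l) * (2 * s - 2 * s0 - h - l) + v (j + 1) / (l * (h + l)) * (2 * s - 2 * s0 - h)) (at s)"
      unfolding H by (rule quadratic)
    moreover have "v (j - 1) / (h * (h + l)) * (2 * s - 2 * s0 - 2 * h - l)
       - v j / (h * l) * (2 * s - 2 * s0 - h - l) + v (j + 1) / (l * (h + l)) * (2 * s - 2 * s0 - h)
      = (v (j + 1) - v j) * ((2 * s - s0 - (s0 + h)) / (l * (h + l)))
       - (v j - v (j - 1)) * ((2 * s - (s0 + h) - (s0 + h + l)) / (h * (h + l)))"
    proof -
      \<comment> \<open>Partial fractions: the coefficient of the middle value \<open>v j\<close> belongs to both increments.\<close>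
      have key: "X / (h * l) = Y / (l * (h + l)) + Z / (h * (h + l))" if "(h + l) * X = h * Y + l * Z" for X Y Z
      proof -
        have "X / (h * l) = ((h + l) * X) / (h * l * (h + l))" using hl by simp
        then show ?thesis unfolding that using hl by (simp add: add_divide_distrib)
      qed
      have "(2 * s - 2 * s0 - h - l) / (h * l)
        = (2 * s - s0 - (s0 + h)) / (l * (h + l)) + (2 * s - (s0 + h) - (s0 + h + l)) / (h * (h + l))"
        by (rule key) (simp add: algebra_simps)
      then have "v j / (h * l) * (2 * s - 2 * s0 - h - l) = v j * ((2 * s - s0 - (s0 + h)) / (l * (h + l)))
          + v j * ((2 * s - (s0 + h) - (s0 + h + l)) / (h * (h + l)))"
        by (metis distrib_left times_divide_eq_left times_divide_eq_right)
      moreover have "v i / D * X = v i * (X / D)" for i D X by simp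
      moreover have "2 * s - 2 * s0 - 2 * h - l = 2 * s - (s0 + h) - (s0 + h + l)"
        "2 * s - 2 * s0 - h = 2 * s - s0 - (s0 + h)" by simp_all
      ultimately show ?thesis by (simp only: left_diff_distrib)
    qed
    ultimately show "(H2 t v j has_real_derivative y (j + 1) * ((2 * s - t (j - 1) - t j) / (step t (j + 1) * (step t j + step t (j + 1))))
       - y j * ((2 * s - t j - t (j + 1)) / (step t j * (step t j + step t (j + 1))))) (at s)"
      unfolding h_def[symmetric] l_def[symmetric] nodes s0_def[symmetric] y_def by simp
  qed
  have int: "integral S (\<lambda>s. deriv (H2 t v j) s / (t k - s) powr \<alpha>)
    = y (j + 1) * integral S (\<lambda>s. (2 * s - t (j - 1) - t j) / (step t (j + 1) * (step t j + step t (j + 1))) * (1 / (t k - s) powr \<alpha>))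
      - y j * integral S (\<lambda>s. (2 * s - t j - t (j + 1)) / (step t j * (step t j + step t (j + 1))) * (1 / (t k - s) powr \<alpha>))"
    if "1 \<le> j"
      and "(\<lambda>s. (2 * s - t (j - 1) - t j) / (step t (j + 1) * (step t j + step t (j + 1))) * (1 / (t k - s) powr \<alpha>)) integrable_on S"
      and "(\<lambda>s. (2 * s - t j - t (j + 1)) / (step t j * (step t j + step t (j + 1))) * (1 / (t k - s) powr \<alpha>)) integrable_on S"
    for S j
  proof -
    have linear: "integral S (\<lambda>s. a * F s - b * G s) = a * integral S F - b * integral S G"
      if "F integrable_on S" "G integrable_on S" for a b :: real and F G
      using that by (simp add: integral_diff integrable_on_mult_right)
    have "deriv (H2 t v j) s / (t k - s) powr \<alpha>
      = y (j + 1) * ((2 * s - t (j - 1) - t j) / (step t (j + 1) * (step t j + step t (j + 1))) * (1 / (t k - s) powr \<alpha>))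
        - y j * ((2 * s - t j - t (j + 1)) / (step t j * (step t j + step t (j + 1))) * (1 / (t k - s) powr \<alpha>))" for s
      unfolding deriv_H2[OF that(1)] diff_divide_distrib[of _ _ "(t k - s) powr \<alpha>"] by simp
    then show ?thesis using linear[OF that(2,3)] by (simp only:)
  qed
  have below: "integral {t (j - 1)..t j} (\<lambda>s. deriv (H2 t v j) s / (t k - s) powr \<alpha>)
    = c_coef \<alpha> t k j * y (j + 1) - a_coef \<alpha> t k j * y j" if "1 \<le> j" "j < k" for j
  proof -
    have "0 < step t j * (step t j + step t (j + 1))" "0 < step t (j + 1) * (step t j + step t (j + 1))"
      using step_pos[of j] step_pos[of "j + 1"] that by auto
    then show ?thesis
      using that t_less[of j k]
      by (subst int) (auto simp: a_coef_def c_coef_def intro!: integrable_continuous_interval continuous_intros)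
  qed
  have sum_below: "(\<Sum>j = 1..k - 1. integral {t (j - 1)..t j} (\<lambda>s. deriv (H2 t v j) s / (t k - s) powr \<alpha>))
    = (\<Sum>j = 1..k - 1. c_coef \<alpha> t k j * y (j + 1) - a_coef \<alpha> t k j * y j)"
    using assms(1) by (intro sum.cong refl below) auto
  have top: "integral {t (k - 1)..t k} (\<lambda>s. deriv (H2 t v (k - 1)) s / (t k - s) powr \<alpha>)
    = c_coef \<alpha> t k k * y k - a_coef \<alpha> t k k * y (k - 1)"
  proof -
    have k: "k - 1 - 1 = k - 2" "k - 1 + 1 = k" "1 \<le> k - 1" using assms by auto
    show ?thesis
      using int[of "k - 1" "{t (k - 1)..t k}", OF k(3), unfolded k(1,2), OF c_coef_diag(2)[OF assms(1)] a_coef_diag(2)[OF assms(1)]]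
      by (simp add: a_coef_def c_coef_def)
  qed
  have shift: "(\<Sum>j = 1..m. c_coef \<alpha> t k j * y (j + 1)) = c_coef \<alpha> t k m * y (m + 1) + (\<Sum>j = 1..m. c_coef \<alpha> t k (j - 1) * y j)" for m
    using assms(1) by (induction m) (simp_all add: c_coef_0)
  have "0 < Gamma (1 - \<alpha>)" using \<alpha> by (intro Gamma_real_pos) simp
  then have "Gamma (1 - \<alpha>) * L2_op \<alpha> t k v
    = (\<Sum>j = 1..k - 1. c_coef \<alpha> t k j * y (j + 1) - a_coef \<alpha> t k j * y j) + (c_coef \<alpha> t k k * y k - a_coef \<alpha> t k k * y (k - 1))"
    using assms(1) sum_below unfolding L2_op_def top by simp
  also have "(\<Sum>j = 1..k - 1. c_coef \<alpha> t k j * y (j + 1) - a_coef \<alpha> t k j * y j)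
      = c_coef \<alpha> t k (k - 1) * y k + (\<Sum>j = 1..k - 1. d_coef \<alpha> t k j * y j)"
    using shift[of "k - 1"] assms(1) by (simp add: sum_subtractf d_coef_def left_diff_distrib)
  finally show ?thesis by (simp add: algebra_simps)
qed

lemma L2_op_1:
  "Gamma (1 - \<alpha>) * L2_op \<alpha> t 1 v = 1 / ((1 - \<alpha>) * step t 1 powr \<alpha>) * (v 1 - v 0)"
proof -
  have pos: "0 < Gamma (1 - \<alpha>)" using \<alpha> by (intro Gamma_real_pos) simp
  have "Gamma (2 - \<alpha>) = Gamma ((1 - \<alpha>) + 1)" by (simp add: algebra_simps)
  also have "\<dots> = (1 - \<alpha>) * Gamma (1 - \<alpha>)"
    using \<alpha> by (intro Gamma_plus1) (auto elim!: nonpos_Ints_cases)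
  finally show ?thesis using pos by (simp add: L2_op_def)
qed

lemma Gamma_3_minus: "Gamma (3 - \<alpha>) = (1 - \<alpha>) * (2 - \<alpha>) * Gamma (1 - \<alpha>)"
proof -
  have "Gamma (3 - \<alpha>) = Gamma ((1 - \<alpha>) + 1 + 1)" by (simp add: algebra_simps)
  also have "\<dots> = ((1 - \<alpha>) + 1) * ((1 - \<alpha>) * Gamma (1 - \<alpha>))"
    using \<alpha> by (subst Gamma_plus1, force elim!: nonpos_Ints_cases)+ simp
  finally show ?thesis by (simp add: algebra_simps)
qed

text \<open>
  The history terms are bounded below by the negative squares with coefficients
  \<open>square_coef\<close>, and \<open>d_coef\<close> in the last row, because the squares in
  \<open>quadratic_form_ge_squares\<close> have nonnegative weights. The rest is the tridiagonal form.
\<close>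

lemma pointwise_energy_bound:
  fixes v :: "nat \<Rightarrow> real"
  assumes n: "2 \<le> n"
  shows "(\<Sum>k = 1..n. g_coef \<alpha> t n k / (2 * Gamma (3 - \<alpha>)) * (v k - v (k - 1))\<^sup>2)
    \<le> (\<Sum>k = 1..n. L2_op \<alpha> t k v * (v k - v (k - 1)))"
proof -
  define y where "y = (\<lambda>j. v j - v (j - 1))"
  define G where "G = (\<lambda>k. 2 * c_coef \<alpha> t k k + 2 * c_coef \<alpha> t k (k - 1)
           - square_coef \<alpha> t k - a_coef \<alpha> t k k - a_coef \<alpha> t (k + 1) (k + 1))"
  define E where "E = C_mat \<alpha> t $ 1 $ 1 * (y 1)\<^sup>2 - 2 * a_coef \<alpha> t 2 2 * y 1 * y 2 + C_mat \<alpha> t $ 2 $ 2 * (y 2)\<^sup>2"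
  define \<kappa> where "\<kappa> = (1 - \<alpha>) * (2 - \<alpha>)"
  have \<kappa>: "0 < \<kappa>" using \<alpha> by (simp add: \<kappa>_def)
  have \<Gamma>: "0 < Gamma (1 - \<alpha>)" using \<alpha> by (intro Gamma_real_pos) simp
  have split_first: "(\<Sum>k = 1..n. f k) = f 1 + (\<Sum>k = 2..n. f k)" for f :: "nat \<Rightarrow> real"
    using n sum.atLeast_Suc_atMost[of 1 n f] by (simp add: numeral_2_eq_2)
  have "2 * Gamma (1 - \<alpha>) * (\<Sum>k = 1..n. L2_op \<alpha> t k v * y k)
      = (\<Sum>k = 1..n. 2 * (Gamma (1 - \<alpha>) * L2_op \<alpha> t k v) * y k)"
    by (simp add: sum_distrib_left mult.assoc)
  also have "\<dots> = 2 / ((1 - \<alpha>) * step t 1 powr \<alpha>) * (y 1)\<^sup>2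
      + (\<Sum>k = 2..n. 2 * (Gamma (1 - \<alpha>) * L2_op \<alpha> t k v) * y k)"
    unfolding split_first L2_op_1 by (simp add: y_def power2_eq_square)
  also have "(\<Sum>k = 2..n. 2 * (Gamma (1 - \<alpha>) * L2_op \<alpha> t k v) * y k)
      = (\<Sum>k = 2..n. (2 * (c_coef \<alpha> t k k + c_coef \<alpha> t k (k - 1)) * (y k)\<^sup>2 - 2 * a_coef \<alpha> t k k * y (k - 1) * y k)
          + 2 * (y k * (\<Sum>j = 1..k - 1. d_coef \<alpha> t k j * y j)))"
  proof (intro sum.cong refl)
    fix k assume "k \<in> {2..n}"
    then have "2 \<le> k" by simp
    show "2 * (Gamma (1 - \<alpha>) * L2_op \<alpha> t k v) * y k
      = (2 * (c_coef \<alpha> t k k + c_coef \<alpha> t k (k - 1)) * (y k)\<^sup>2 - 2 * a_coef \<alpha> t k k * y (k - 1) * y k)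
          + 2 * (y k * (\<Sum>j = 1..k - 1. d_coef \<alpha> t k j * y j))"
      unfolding L2_op_eq[OF \<open>2 \<le> k\<close>] y_def[symmetric] fun_cong[OF y_def[symmetric]]
      by (simp add: algebra_simps power2_eq_square)
  qed
  also have "\<dots> = (\<Sum>k = 2..n. 2 * (c_coef \<alpha> t k k + c_coef \<alpha> t k (k - 1)) * (y k)\<^sup>2 - 2 * a_coef \<alpha> t k k * y (k - 1) * y k)
      + 2 * (\<Sum>k = 2..n. y k * (\<Sum>j = 1..k - 1. d_coef \<alpha> t k j * y j))"
    by (simp only: sum.distrib sum_distrib_left)
  also have "(\<Sum>k = 2..n. y k * (\<Sum>j = 1..k - 1. d_coef \<alpha> t k j * y j))
      = (\<Sum>k = 1..n. y k * (\<Sum>j = 1..k - 1. d_coef \<alpha> t k j * y j))"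
    unfolding split_first by simp
  finally have energy: "2 * Gamma (1 - \<alpha>) * (\<Sum>k = 1..n. L2_op \<alpha> t k v * y k)
    = 2 / ((1 - \<alpha>) * step t 1 powr \<alpha>) * (y 1)\<^sup>2
      + (\<Sum>k = 2..n. 2 * (c_coef \<alpha> t k k + c_coef \<alpha> t k (k - 1)) * (y k)\<^sup>2 - 2 * a_coef \<alpha> t k k * y (k - 1) * y k)
      + 2 * (\<Sum>k = 1..n. y k * (\<Sum>j = 1..k - 1. d_coef \<alpha> t k j * y j))"
    by simp
  have "0 \<le> (\<Sum>j = 1..n - 1. (d_coef \<alpha> t n j - d_coef \<alpha> t n (j - 1)) * (\<Sum>i = j..n. y i)\<^sup>2)"
    by (intro sum_nonneg mult_nonneg_nonneg d_coef_increment_nonneg) auto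
  also have "\<dots> \<le> 2 * (\<Sum>k = 1..n. y k * (\<Sum>j = 1..k - 1. d_coef \<alpha> t k j * y j))
      + (\<Sum>k = 1..n - 1. square_coef \<alpha> t k * (y k)\<^sup>2) + d_coef \<alpha> t n (n - 1) * (y n)\<^sup>2"
    unfolding square_coef_def using n d_coef_increment_antimono
    by (intro quadratic_form_ge_squares) (auto simp: d_coef_0)
  finally have "E + (\<Sum>k = 3..n. G k * (y k)\<^sup>2)
        + (square_coef \<alpha> t n + a_coef \<alpha> t (n + 1) (n + 1) - d_coef \<alpha> t n (n - 1)) * (y n)\<^sup>2
      \<le> 2 * Gamma (1 - \<alpha>) * (\<Sum>k = 1..n. L2_op \<alpha> t k v * y k)"
    using tridiagonal_form_ge[OF n, of y] unfolding energy E_def G_def left_diff_distrib[of _ _ "(y n)\<^sup>2"]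
    by linarith
  then have low: "\<kappa> * (E + (\<Sum>k = 3..n. G k * (y k)\<^sup>2)
        + (square_coef \<alpha> t n + a_coef \<alpha> t (n + 1) (n + 1) - d_coef \<alpha> t n (n - 1)) * (y n)\<^sup>2)
      \<le> \<kappa> * (2 * Gamma (1 - \<alpha>) * (\<Sum>k = 1..n. L2_op \<alpha> t k v * y k))"
    using \<kappa> by (intro mult_left_mono) auto
  have E: "g_coef \<alpha> t n 1 * (y 1)\<^sup>2 + g_coef \<alpha> t n 2 * (y 2)\<^sup>2 \<le> \<kappa> * E"
  proof -
    have "g_coef \<alpha> t n 1 = g_coef \<alpha> t n 2"
      using g_coef_start[of 1 n] g_coef_start[of 2 n] by simp
    then show ?thesis
      using start_form_ge[of 2 n "y 1" "y 2"] unfolding \<kappa>_def[symmetric] E_def[symmetric]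
      by (simp add: distrib_left)
  qed
  have "(\<Sum>k = 1..n. g_coef \<alpha> t n k * (y k)\<^sup>2)
    \<le> \<kappa> * (E + (\<Sum>k = 3..n. G k * (y k)\<^sup>2)
        + (square_coef \<alpha> t n + a_coef \<alpha> t (n + 1) (n + 1) - d_coef \<alpha> t n (n - 1)) * (y n)\<^sup>2)"
  proof (cases "n = 2")
    case True
    have "0 \<le> square_coef \<alpha> t 2 + a_coef \<alpha> t 3 3 - d_coef \<alpha> t 2 1"
      using d_coef_increment_nonneg[of 2 3] a_coef_diag_nonneg[of 3] by (simp add: square_coef_def)
    then have "0 \<le> \<kappa> * ((square_coef \<alpha> t 2 + a_coef \<alpha> t 3 3 - d_coef \<alpha> t 2 1) * (y 2)\<^sup>2)"
      using \<kappa> by simp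
    moreover have "(\<Sum>k = 1..2. f k) = f 1 + f 2" for f :: "nat \<Rightarrow> real" by (simp add: numeral_2_eq_2)
    ultimately show ?thesis using E unfolding True by (simp add: distrib_left)
  next
    case False
    then obtain m where m: "n = Suc m" "2 \<le> m" using n by (cases n) auto
    have "(\<Sum>k = 1..n. g_coef \<alpha> t n k * (y k)\<^sup>2)
      = g_coef \<alpha> t n 1 * (y 1)\<^sup>2 + g_coef \<alpha> t n 2 * (y 2)\<^sup>2
        + (\<Sum>k = 3..m. g_coef \<alpha> t n k * (y k)\<^sup>2) + g_coef \<alpha> t n n * (y n)\<^sup>2"
      unfolding split_first using m sum.atLeast_Suc_atMost[of 2 m] by (simp add: numeral_3_eq_3 numeral_2_eq_2)
    also have "(\<Sum>k = 3..m. g_coef \<alpha> t n k * (y k)\<^sup>2) \<le> (\<Sum>k = 3..m. \<kappa> * (G k * (y k)\<^sup>2))"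
    proof (rule sum_mono)
      fix k assume "k \<in> {3..m}"
      then have "g_coef \<alpha> t n k * (y k)\<^sup>2 \<le> (\<kappa> * G k) * (y k)\<^sup>2"
        unfolding \<kappa>_def G_def using m by (intro mult_right_mono g_coef_interior) auto
      then show "g_coef \<alpha> t n k * (y k)\<^sup>2 \<le> \<kappa> * (G k * (y k)\<^sup>2)" by simp
    qed
    also have "g_coef \<alpha> t n n * (y n)\<^sup>2
      \<le> \<kappa> * (G n + (square_coef \<alpha> t n + a_coef \<alpha> t (n + 1) (n + 1) - d_coef \<alpha> t n (n - 1))) * (y n)\<^sup>2"
      using g_coef_last[of n] m by (intro mult_right_mono) (auto simp: \<kappa>_def G_def algebra_simps)
    finally show ?thesis using E m by (simp add: algebra_simps sum_distrib_left)
  qed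
  also note low
  also have "\<kappa> * (2 * Gamma (1 - \<alpha>) * (\<Sum>k = 1..n. L2_op \<alpha> t k v * y k))
    = 2 * Gamma (3 - \<alpha>) * (\<Sum>k = 1..n. L2_op \<alpha> t k v * y k)"
    by (simp add: Gamma_3_minus \<kappa>_def)
  finally have "(\<Sum>k = 1..n. g_coef \<alpha> t n k * (y k)\<^sup>2) / (2 * Gamma (3 - \<alpha>)) \<le> (\<Sum>k = 1..n. L2_op \<alpha> t k v * y k)"
    using \<Gamma> \<kappa> by (simp add: Gamma_3_minus \<kappa>_def[symmetric] pos_divide_le_eq mult.commute)
  then show ?thesis by (simp add: sum_divide_distrib y_def)
qed

section \<open>Uniform positivity of the coefficients\<close>

text \<open>
  Both rows of \<open>C_mat\<close> are strictly diagonally dominant. This bounds the smaller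
  eigenvalue without any computation of the determinant.
\<close>

lemma start_diagonal_dominance:
  shows "step t 1 powr (- \<alpha>) / 2 \<le> (1 - \<alpha>) * (2 - \<alpha>) * (C_mat \<alpha> t $ 1 $ 1 - a_coef \<alpha> t 2 2)"
    and "\<alpha> * (1 - \<alpha>)\<^sup>2 * step t 2 powr (- \<alpha>) \<le> (1 - \<alpha>) * (2 - \<alpha>) * (C_mat \<alpha> t $ 2 $ 2 - a_coef \<alpha> t 2 2)"
proof -
  define x where "x = ratio t 2"
  define w where "w = step t 1 powr (- \<alpha>)"
  have x: "0 < x" "x \<le> rho_R" "step t 2 = x * step t 1" using ratio_bounds[of 2] by (auto simp: x_def)
  have y: "0 < ratio t 3" "ratio t 3 \<le> rho_R" using ratio_bounds[of 3] by auto
  have \<tau>: "0 < step t 1" "0 < step t 2" using step_pos by auto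
  define Z1 where "Z1 = 2 * (2 - \<alpha>)"
  define Z2 where "Z2 = (1 + x) powr (- \<alpha>) * (2 * (1 - \<alpha>) - \<alpha> * x) + \<alpha> * x powr (2 - \<alpha>) / (1 + x)"
  define Z3 where "Z3 = \<alpha> * x powr (2 - \<alpha>) / (1 + x)"
  have "(1 - \<alpha>) * (2 - \<alpha>) * a_coef \<alpha> t 2 2 = w * Z3"
  proof -
    have "step t 2 powr (- \<alpha>) = w * x powr (- \<alpha>)"
      unfolding x(3) w_def using x(1) \<tau> by (simp add: powr_mult)
    moreover have "x powr (2 - \<alpha>) = x\<^sup>2 * x powr (- \<alpha>)" using x by (simp add: powr_diff powr_minus_divide)
    ultimately show ?thesis using a_coef_diag(1)[of 2] by (simp add: x_def Z3_def)
  qed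
  moreover have "(1 - \<alpha>) * (2 - \<alpha>) * - a_coef \<alpha> t 2 1 = w * Z2"
    using a_coef_subdiag[of 1] by (simp add: x_def w_def Z2_def numeral_2_eq_2)
  moreover have "(1 - \<alpha>) * (2 - \<alpha>) * (2 / ((1 - \<alpha>) * step t 1 powr \<alpha>)) = w * Z1"
    using \<alpha> by (simp add: w_def Z1_def powr_minus_divide)
  moreover have "\<kappa> * (p + q - r) = \<kappa> * p - \<kappa> * - q - \<kappa> * r" for \<kappa> p q r :: real
    by (simp add: algebra_simps)
  ultimately have "(1 - \<alpha>) * (2 - \<alpha>) * (C_mat \<alpha> t $ 1 $ 1 - a_coef \<alpha> t 2 2) = w * Z1 - w * Z2 - w * Z3"
    unfolding C_mat_entries(1) by (simp only:)
  also have "\<dots> = w * (Z1 - Z2 - Z3)" by (simp only: right_diff_distrib)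
  finally have "(1 - \<alpha>) * (2 - \<alpha>) * (C_mat \<alpha> t $ 1 $ 1 - a_coef \<alpha> t 2 2) = w * (Z1 - Z2 - Z3)" .
  moreover have "w * (1 / 2) \<le> w * (Z1 - Z2 - Z3)"
    unfolding Z1_def Z2_def Z3_def
    by (rule mult_left_mono[OF first_row_dominance[OF \<alpha> x(1,2)]]) (simp add: w_def)
  ultimately show "step t 1 powr (- \<alpha>) / 2 \<le> (1 - \<alpha>) * (2 - \<alpha>) * (C_mat \<alpha> t $ 1 $ 1 - a_coef \<alpha> t 2 2)"
    unfolding w_def[symmetric] by simp
  have "\<alpha> / step t 2 powr \<alpha> * (1 - \<alpha>)\<^sup>2 \<le> \<alpha> / step t 2 powr \<alpha> * ((1 + \<alpha>) * (2 - \<alpha>) / \<alpha>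
      + (ratio t 3 - 1 + \<alpha>) / (1 + ratio t 3) powr \<alpha>
      - 2 * ratio t 3 powr (2 - \<alpha>) / (1 + ratio t 3) - x * (x - 2) / (1 + x))"
    by (rule mult_left_mono[OF interior_coefficient_pos[OF \<alpha> x(1,2) y]]) (use \<alpha> in simp)
  also have "\<dots> \<le> (1 - \<alpha>) * (2 - \<alpha>) * (C_mat \<alpha> t $ 2 $ 2 - a_coef \<alpha> t 2 2)"
  proof -
    have eq: "C_mat \<alpha> t $ 2 $ 2 - a_coef \<alpha> t 2 2 = 2 * c_coef \<alpha> t 2 2 + 2 * c_coef \<alpha> t 2 (2 - 1)
        - square_coef \<alpha> t 2 - a_coef \<alpha> t 2 2 - a_coef \<alpha> t (2 + 1) (2 + 1)"
      by (simp add: C_mat_entries(4))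
    show ?thesis unfolding x_def eq using interior_diagonal_ge[of 2] by simp
  qed
  finally show "\<alpha> * (1 - \<alpha>)\<^sup>2 * step t 2 powr (- \<alpha>) \<le> (1 - \<alpha>) * (2 - \<alpha>) * (C_mat \<alpha> t $ 2 $ 2 - a_coef \<alpha> t 2 2)"
    by (simp add: powr_minus_divide)
qed

text \<open>
  For \<open>k \<ge> 3\<close> this is immediate from the inequalities for the ratios, without the factor
  \<open>1 / 4\<close>. That factor is there for \<open>k \<le> 2\<close>, where the same eigenvalue has to be compared
  with powers of both \<open>step t 1\<close> and \<open>step t 2\<close>.
\<close>

lemma g_coef_ge:
  assumes "2 \<le> n" "1 \<le> k" "k \<le> n"
  shows "\<alpha> * (1 - \<alpha>)\<^sup>2 / 4 * step t k powr (- \<alpha>) \<le> g_coef \<alpha> t n k"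
proof -
  define m where "m = \<alpha> * (1 - \<alpha>)\<^sup>2"
  have m: "0 \<le> m" using \<alpha> by (simp add: m_def)
  have quarter: "m / 4 * w \<le> \<alpha> / step t j powr \<alpha> * F"
    if "w = step t j powr (- \<alpha>)" "(1 - \<alpha>)\<^sup>2 \<le> F" for w F j
  proof -
    have "m / 4 * w \<le> m * w" using m that(1) by simp
    also have "\<dots> = \<alpha> / step t j powr \<alpha> * (1 - \<alpha>)\<^sup>2" by (simp add: that(1) m_def powr_minus_divide)
    also have "\<dots> \<le> \<alpha> / step t j powr \<alpha> * F" using that \<alpha> by (intro mult_left_mono) auto
    finally show ?thesis .
  qed
  consider "k \<le> 2" | "3 \<le> k" "k < n" | "3 \<le> k" "k = n" using assms by linarith
  then have "m / 4 * step t k powr (- \<alpha>) \<le> g_coef \<alpha> t n k"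
  proof cases
    case 1
    define x where "x = ratio t 2"
    have x: "step t 2 = x * step t 1" "0 < x" using ratio_bounds[of 2] by (auto simp: x_def)
    define w where "w = step t 1 powr (- \<alpha>)"
    define z where "z = x powr (- \<alpha>)"
    have z: "1 / 4 \<le> z" "z \<le> 4"
      unfolding z_def x_def using powr_ratio_bounds[OF \<alpha>, of "ratio t 2"] ratio_bounds[of 2] by auto
    have w: "0 \<le> w" by (simp add: w_def)
    have w2: "step t 2 powr (- \<alpha>) = w * z"
      unfolding x(1) w_def z_def using x(2) step_pos[of 1] by (simp add: powr_mult)
    have kw: "step t k powr (- \<alpha>) = w \<or> step t k powr (- \<alpha>) = w * z"
    proof -
      have "k = 1 \<or> k = 2" using 1 assms by auto
      then show ?thesis using w2 w_def by metis
    qed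
    \<comment> \<open>The first row only provides the constant \<open>1 / 2\<close>.\<close>
    have m2: "m \<le> 1 / 2"
    proof -
      have "m = \<alpha> * (1 - \<alpha>) * (1 - \<alpha>)" by (simp add: m_def power2_eq_square)
      also have "\<dots> \<le> 1 / 4 * 1"
      proof (rule mult_mono)
        have "0 \<le> (\<alpha> - 1 / 2)\<^sup>2" by simp
        then show "\<alpha> * (1 - \<alpha>) \<le> 1 / 4" by (simp add: power2_eq_square algebra_simps)
      qed (use \<alpha> in auto)
      finally show ?thesis by simp
    qed
    have "step t k powr (- \<alpha>) \<le> 4 * w"
      using kw mult_left_mono[OF z(2) w] w by auto
    then have "m / 4 * step t k powr (- \<alpha>) \<le> m / 4 * (4 * w)" using m by (intro mult_left_mono) auto
    also have "\<dots> \<le> 1 / 2 * w" using m2 w mult_right_mono[OF m2 w] by simp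
    finally have row1: "m / 4 * step t k powr (- \<alpha>) \<le> w / 2" by simp
    have "step t k powr (- \<alpha>) \<le> 4 * (w * z)"
      using kw mult_left_mono[OF z(1) w] w z by auto
    then have "m / 4 * step t k powr (- \<alpha>) \<le> m / 4 * (4 * (w * z))" using m by (intro mult_left_mono) auto
    then have row2: "m / 4 * step t k powr (- \<alpha>) \<le> m * step t 2 powr (- \<alpha>)" by (simp add: w2)
    define \<kappa> where "\<kappa> = (1 - \<alpha>) * (2 - \<alpha>)"
    have \<kappa>: "0 < \<kappa>" using \<alpha> by (simp add: \<kappa>_def)
    define M where "M = m / 4 * step t k powr (- \<alpha>) / \<kappa>"
    have M: "\<kappa> * M = m / 4 * step t k powr (- \<alpha>)" using \<kappa> by (simp add: M_def)
    have "\<kappa> * M \<le> \<kappa> * (C_mat \<alpha> t $ 1 $ 1 - a_coef \<alpha> t 2 2)"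
      unfolding M by (rule order_trans[OF row1 start_diagonal_dominance(1)[folded \<kappa>_def w_def]])
    moreover have "\<kappa> * M \<le> \<kappa> * (C_mat \<alpha> t $ 2 $ 2 - a_coef \<alpha> t 2 2)"
      unfolding M by (rule order_trans[OF row2 start_diagonal_dominance(2)[folded \<kappa>_def m_def]])
    ultimately have "M \<le> C_mat \<alpha> t $ 1 $ 1 - a_coef \<alpha> t 2 2" "M \<le> C_mat \<alpha> t $ 2 $ 2 - a_coef \<alpha> t 2 2"
      using \<kappa> by auto
    then have "M \<le> (C_mat \<alpha> t $ 1 $ 1 + C_mat \<alpha> t $ 2 $ 2
      - sqrt ((C_mat \<alpha> t $ 1 $ 1 - C_mat \<alpha> t $ 2 $ 2)\<^sup>2 + 4 * (- a_coef \<alpha> t 2 2) * (- a_coef \<alpha> t 2 2))) / 2"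
      using a_coef_diag_nonneg[of 2] by (intro min_eigenvalue_ge) auto
    then show ?thesis
      unfolding g_coef_start[OF 1] M[symmetric] \<kappa>_def[symmetric] using \<kappa> by (intro mult_left_mono) auto
  next
    case 2
    then show ?thesis
      using quarter[OF refl interior_coefficient_pos[OF \<alpha>, of "ratio t k" "ratio t (k + 1)"], of k]
        ratio_bounds[of k] ratio_bounds[of "k + 1"] by (simp add: g_coef_def)
  next
    case 3
    then show ?thesis
      using quarter[OF refl last_coefficient_pos[OF \<alpha>, of "ratio t k"], of k]
        ratio_bounds[of k] by (simp add: g_coef_def)
  qed
  then show ?thesis by (simp add: m_def)
qed

section \<open>The energy inequality\<close>

text \<open>
  For fixed \<open>k\<close> the operator is a finite linear combination of increments, so the product
  is one of products of square integrable functions.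
\<close>

lemma integrable_L2_op_mult:
  fixes v :: "'a \<Rightarrow> nat \<Rightarrow> real"
  assumes k: "1 \<le> k" and v: "\<And>i. square_integrable M (\<lambda>x. v x i)" and f: "square_integrable M f"
  shows "integrable M (\<lambda>x. L2_op \<alpha> t k (v x) * f x)"
proof -
  have \<Gamma>: "0 < Gamma (1 - \<alpha>)" using \<alpha> by (intro Gamma_real_pos) simp
  have y: "integrable M (\<lambda>x. (v x i - v x j) * f x)" for i j
    by (intro square_integrable_mult square_integrable_diff v f)
  have "integrable M (\<lambda>x. Gamma (1 - \<alpha>) * L2_op \<alpha> t k (v x) * f x)"
  proof (cases "k = 1")
    case True
    show ?thesis unfolding True L2_op_1 using y[of 1 0] by (simp add: mult.assoc)
  next
    case False
    then have "2 \<le> k" using k by simp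
    have "Gamma (1 - \<alpha>) * L2_op \<alpha> t k (v x) * f x
      = (c_coef \<alpha> t k k + c_coef \<alpha> t k (k - 1)) * ((v x k - v x (k - 1)) * f x)
        - a_coef \<alpha> t k k * ((v x (k - 1) - v x (k - 1 - 1)) * f x)
        + (\<Sum>j = 1..k - 1. d_coef \<alpha> t k j * ((v x j - v x (j - 1)) * f x))" for x
      unfolding L2_op_eq[OF \<open>2 \<le> k\<close>] by (simp add: distrib_right left_diff_distrib sum_distrib_right mult.assoc)
    then show ?thesis
      by (simp only:) (intro Bochner_Integration.integrable_add Bochner_Integration.integrable_diff
          Bochner_Integration.integrable_sum integrable_mult_right y)
  qed
  from integrable_mult_right[OF this, of "1 / Gamma (1 - \<alpha>)"] \<Gamma> show ?thesis by (simp add: mult.assoc)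
qed

lemma energy_bound:
  fixes M :: "'a measure"
  assumes n: "2 \<le> n" and u: "\<And>k. square_integrable M (u (t k))"
  shows "(\<Sum>k = 1..n. g_coef \<alpha> t n k / (2 * Gamma (3 - \<alpha>)) * (L2_nrm M (delta t u k))\<^sup>2) \<le> bilin M \<alpha> t n u u"
proof -
  have \<delta>: "square_integrable M (delta t u k)" for k
    unfolding delta_def[abs_def] by (intro square_integrable_diff u)
  have nrm: "(L2_nrm M (delta t u k))\<^sup>2 = (LINT x|M. delta t u k x * delta t u k x)" for k
    by (simp add: L2_nrm_def L2_inner_def integral_nonneg_AE)
  have int: "integrable M (\<lambda>x. L2_op \<alpha> t k (\<lambda>i. u (t i) x) * delta t u k x)" if "1 \<le> k" for k
    using integrable_L2_op_mult[OF that, of M "\<lambda>x i. u (t i) x"] u \<delta> by simp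
  have "(\<Sum>k = 1..n. g_coef \<alpha> t n k / (2 * Gamma (3 - \<alpha>)) * (L2_nrm M (delta t u k))\<^sup>2)
     = (LINT x|M. (\<Sum>k = 1..n. g_coef \<alpha> t n k / (2 * Gamma (3 - \<alpha>)) * (delta t u k x * delta t u k x)))"
    unfolding nrm by (subst Bochner_Integration.integral_sum) (auto intro!: integrable_mult_right square_integrable_mult \<delta>)
  also have "\<dots> \<le> (LINT x|M. (\<Sum>k = 1..n. L2_op \<alpha> t k (\<lambda>i. u (t i) x) * delta t u k x))"
  proof (rule integral_mono)
    show "integrable M (\<lambda>x. \<Sum>k = 1..n. g_coef \<alpha> t n k / (2 * Gamma (3 - \<alpha>)) * (delta t u k x * delta t u k x))"
      by (intro Bochner_Integration.integrable_sum integrable_mult_right square_integrable_mult \<delta>)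
    show "integrable M (\<lambda>x. \<Sum>k = 1..n. L2_op \<alpha> t k (\<lambda>i. u (t i) x) * delta t u k x)"
      by (intro Bochner_Integration.integrable_sum int) simp
    show "(\<Sum>k = 1..n. g_coef \<alpha> t n k / (2 * Gamma (3 - \<alpha>)) * (delta t u k x * delta t u k x))
       \<le> (\<Sum>k = 1..n. L2_op \<alpha> t k (\<lambda>i. u (t i) x) * delta t u k x)" for x
      using pointwise_energy_bound[OF n, of "\<lambda>i. u (t i) x"] by (simp add: delta_def power2_eq_square)
  qed
  also have "\<dots> = bilin M \<alpha> t n u u"
    unfolding bilin_def L2_inner_def by (intro Bochner_Integration.integral_sum int) simp
  finally show ?thesis .
qed

end

theorem corollary3p3:
  fixes \<alpha> :: real
  assumes "0 < \<alpha>" and "\<alpha> < 1"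
  shows "\<exists>C > 0. \<forall>t :: nat \<Rightarrow> real.
    is_mesh t \<and> (\<forall>k \<ge> 2. ratio t k \<in> {rho_L..rho_R}) \<longrightarrow>
    (\<forall>(d :: nat) (\<Omega> :: (nat \<Rightarrow> real) set) (u :: real \<Rightarrow> (nat \<Rightarrow> real) \<Rightarrow> real) (n :: nat).
      1 \<le> d \<and> is_domain d \<Omega> \<and> (\<forall>k. square_integrable (lebesgue_dim_on d \<Omega>) (u (t k))) \<and> 2 \<le> n \<longrightarrow>
      bilin (lebesgue_dim_on d \<Omega>) \<alpha> t n u u
        \<ge> (\<Sum>k = 1..n. g_coef \<alpha> t n k / (2 * Gamma (3 - \<alpha>))
              * (L2_nrm (lebesgue_dim_on d \<Omega>) (delta t u k))\<^sup>2)
      \<and> (\<Sum>k = 1..n. g_coef \<alpha> t n k / (2 * Gamma (3 - \<alpha>))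
              * (L2_nrm (lebesgue_dim_on d \<Omega>) (delta t u k))\<^sup>2)
        \<ge> C * (\<Sum>k = 1..n. step t k powr (- \<alpha>)
              * (L2_nrm (lebesgue_dim_on d \<Omega>) (delta t u k))\<^sup>2)
      \<and> C * (\<Sum>k = 1..n. step t k powr (- \<alpha>)
              * (L2_nrm (lebesgue_dim_on d \<Omega>) (delta t u k))\<^sup>2) \<ge> 0)"
proof -
  define c where "c = \<alpha> * (1 - \<alpha>)\<^sup>2 / 4"
  define \<Gamma> where "\<Gamma> = 2 * Gamma (3 - \<alpha>)"
  have pos: "0 < \<Gamma>" "0 < c" using assms by (auto simp: \<Gamma>_def c_def intro!: Gamma_real_pos)
  show ?thesis unfolding \<Gamma>_def[symmetric]
  proof (intro exI[of _ "c / \<Gamma>"] conjI allI impI)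
    show "0 < c / \<Gamma>" using pos by simp
    fix t :: "nat \<Rightarrow> real" and d n :: nat and \<Omega> and u :: "real \<Rightarrow> (nat \<Rightarrow> real) \<Rightarrow> real"
    assume mesh: "is_mesh t \<and> (\<forall>k \<ge> 2. ratio t k \<in> {rho_L..rho_R})"
      and data: "1 \<le> d \<and> is_domain d \<Omega> \<and> (\<forall>k. square_integrable (lebesgue_dim_on d \<Omega>) (u (t k))) \<and> 2 \<le> n"
    interpret graded_mesh \<alpha> t by unfold_locales (use assms mesh in auto)
    show "(\<Sum>k = 1..n. g_coef \<alpha> t n k / \<Gamma> * (L2_nrm (lebesgue_dim_on d \<Omega>) (delta t u k))\<^sup>2)
        \<le> bilin (lebesgue_dim_on d \<Omega>) \<alpha> t n u u"
      unfolding \<Gamma>_def using data by (intro energy_bound) auto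
    have "c * step t k powr (- \<alpha>) / \<Gamma> \<le> g_coef \<alpha> t n k / \<Gamma>" if "k \<in> {1..n}" for k
      using g_coef_ge[of n k] that data pos by (intro divide_right_mono) (auto simp: c_def)
    then show "c / \<Gamma> * (\<Sum>k = 1..n. step t k powr (- \<alpha>) * (L2_nrm (lebesgue_dim_on d \<Omega>) (delta t u k))\<^sup>2)
        \<le> (\<Sum>k = 1..n. g_coef \<alpha> t n k / \<Gamma> * (L2_nrm (lebesgue_dim_on d \<Omega>) (delta t u k))\<^sup>2)"
      unfolding sum_distrib_left mult.assoc[symmetric] by (intro sum_mono mult_right_mono) auto
    show "0 \<le> c / \<Gamma> * (\<Sum>k = 1..n. step t k powr (- \<alpha>) * (L2_nrm (lebesgue_dim_on d \<Omega>) (delta t u k))\<^sup>2)"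
      using pos by (intro mult_nonneg_nonneg sum_nonneg) auto
  qed
qed

end
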